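(* Let $G$ be a finite abelian group, let $g_1,\dots,g_\theta\in G$ and characters $\chi_1,\dots,\chi_\theta:G\to\Bbbk^\times$ be such that $g_i$ and $\chi_i(g_i)$ both have order $n_i\geq 2$ for each $i$, and let $H(G,g_1,\dots,g_\theta,\chi_1,\dots,\chi_\theta)$ be the Hopf algebra defined in the context. Let $L$ be a field containing $\Bbbk$ and equipped with a faithful action of $G$. Then the extensions of the $G$-action on $L$ to a (not necessarily inner faithful) action of $H(G,g_1,\dots,g_\theta,\chi_1,\dots,\chi_\theta)$ on $L$ are exactly those defined by the formula $$x_i\mapsto w_i(1-g_i),\qquad i=1,\dots,\theta,$$ where $w_i\in L$ is such that $g\cdot w_i=\chi_i(g)w_i$ for all $g\in G$. Moreover, for each $g\in G$ and $\chi\in\widehat G$, the skew-primitive elements $\{x_i\mid i\in I_{g,\chi}\}$ are linearly independent as $\Bbbk$-linear operators on $L$ if and only if the elements $\{w_i\mid i\in I_{g,\chi}\}$ are linearly independent over $\Bbbk$; and this can be achieved by an appropriate choice of the $w_i$.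
   Context: $\Bbbk$ is an algebraically closed field of characteristic zero. A Hopf algebra $H$ acts on a field $L\supset\Bbbk$ if $L$ is a left $H$-module algebra over $\Bbbk$; the action is inner faithful if no nonzero Hopf ideal of $H$ annihilates $L$. $G$ acts on $L$ by $\Bbbk$-algebra automorphisms. $H(G,g_1,\dots,g_\theta,\chi_1,\dots,\chi_\theta)$ is the Hopf algebra generated by $G$ (grouplike elements) and elements $x_1,\dots,x_\theta$, where $x_i$ is $(g_i,1)$-skew-primitive, i.e. $\Delta(x_i)=g_i\otimes x_i+x_i\otimes 1$, subject to the relations of $G$ and $$x_i^{n_i}=0,\qquad gx_i=\chi_i(g)x_ig\quad\text{for all } g\in G,\ 1\le i\le\theta.$$ $\widehat G$ is the character group of $G$, and $I_{g,\chi}:=\{1\le i\le\theta\mid g_i=g,\ \chi_i=\chi\}$. The formula $x_i\mapsto w_i(1-g_i)$ means that $x_i\cdot\ell=w_i(\ell-g_i\cdot\ell)$ for $\ell\in L$. *)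

theory Defs
  imports
    "HOL-Algebra.QuotRing"
    "HOL-Algebra.Module"
    "HOL-Algebra.Group_Action"
    "HOL-Algebra.Multiplicative_Group"
    "HOL-Computational_Algebra.Polynomial"
    "HOL-Library.Poly_Mapping"
    "HOL-Library.Product_Plus"
    "HOL-Library.Function_Algebras"
begin

section \<open>Bialgebras over a field\<close>

text \<open>
  The scalars form a type \<open>'k\<close>; algebras live on carrier sets, using the ring and module records
  of HOL-Algebra. For a vector space \<open>V\<close> with carrier in \<open>'v\<close>, the tensor square is the classical
  quotient of the free vector space on pairs: finitely supported functions \<open>'v \<times> 'v \<Rightarrow>\<^sub>0 'k\<close>
  supported on \<open>V \<times> V\<close>, modulo the subspace spanned by the bilinearity relations.
\<close>

abbreviation pm_scale :: "'k::comm_ring_1 \<Rightarrow> ('a \<Rightarrow>\<^sub>0 'k) \<Rightarrow> ('a \<Rightarrow>\<^sub>0 'k)"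
  where "pm_scale c \<equiv> Poly_Mapping.map ((*) c)"

definition tensor_rels :: "('k::field, 'v, 'm) module_scheme \<Rightarrow> ('v \<times> 'v \<Rightarrow>\<^sub>0 'k) set"
  where "tensor_rels V =
    {Poly_Mapping.single (a \<oplus>\<^bsub>V\<^esub> b, c) 1 - Poly_Mapping.single (a, c) 1 - Poly_Mapping.single (b, c) 1
       | a b c. a \<in> carrier V \<and> b \<in> carrier V \<and> c \<in> carrier V} \<union>
    {Poly_Mapping.single (a, b \<oplus>\<^bsub>V\<^esub> c) 1 - Poly_Mapping.single (a, b) 1 - Poly_Mapping.single (a, c) 1
       | a b c. a \<in> carrier V \<and> b \<in> carrier V \<and> c \<in> carrier V} \<union>
    {Poly_Mapping.single (s \<odot>\<^bsub>V\<^esub> a, b) 1 - Poly_Mapping.single (a, b) s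
       | s a b. a \<in> carrier V \<and> b \<in> carrier V} \<union>
    {Poly_Mapping.single (a, s \<odot>\<^bsub>V\<^esub> b) 1 - Poly_Mapping.single (a, b) s
       | s a b. a \<in> carrier V \<and> b \<in> carrier V}"

definition tensor_null :: "('k::field, 'v, 'm) module_scheme \<Rightarrow> ('v \<times> 'v \<Rightarrow>\<^sub>0 'k) set"
  where "tensor_null V = module.span pm_scale (tensor_rels V)"

text \<open>The element of the tensor square represented by \<open>t\<close>, as the set of all its representatives.\<close>

definition tensor_class ::
    "('k::field, 'v, 'm) module_scheme \<Rightarrow> ('v \<times> 'v \<Rightarrow>\<^sub>0 'k) \<Rightarrow> ('v \<times> 'v \<Rightarrow>\<^sub>0 'k) set"
  where "tensor_class V t = {s. Poly_Mapping.keys s \<subseteq> carrier V \<times> carrier V \<and> s - t \<in> tensor_null V}"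

text \<open>
  The antipode of a Hopf algebra is determined by the bialgebra structure and does not occur in the
  axioms of a module algebra, so it is not part of the record.
\<close>

record (overloaded) ('k, 'h) bialgebra = "('k, 'h) module" +
  comult :: "'h \<Rightarrow> ('h \<times> 'h \<Rightarrow>\<^sub>0 'k) set"
  counit :: "'h \<Rightarrow> 'k"


section \<open>Actions on a field extension\<close>

definition field_embedding :: "('k::field \<Rightarrow> 'l::field) \<Rightarrow> bool"
  where "field_embedding \<iota> \<longleftrightarrow>
    \<iota> 1 = 1 \<and> (\<forall>a b. \<iota> (a + b) = \<iota> a + \<iota> b) \<and> (\<forall>a b. \<iota> (a * b) = \<iota> a * \<iota> b)"

definition algebra_automorphism :: "('k::field \<Rightarrow> 'l::field) \<Rightarrow> ('l \<Rightarrow> 'l) \<Rightarrow> bool"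
  where "algebra_automorphism \<iota> f \<longleftrightarrow>
    bij f \<and> (\<forall>a b. f (a + b) = f a + f b) \<and> (\<forall>a b. f (a * b) = f a * f b) \<and> (\<forall>c. f (\<iota> c) = \<iota> c)"

text \<open>
  \<open>\<rho> h \<ell>\<close> is \<open>h \<cdot> \<ell>\<close>. The first group of clauses says that \<open>L\<close> (the whole type \<open>'l\<close>, a \<open>'k\<close>-algebra
  through \<open>\<iota>\<close>) is a left \<open>H\<close>-module; the last two are
  \<open>h \<cdot> (a b) = \<Sum> (h\<^sub>1 \<cdot> a) (h\<^sub>2 \<cdot> b)\<close> and \<open>h \<cdot> 1 = \<epsilon>(h) 1\<close>. The values of \<open>\<rho>\<close> outside
  \<open>carrier H\<close> are irrelevant.
\<close>

definition module_algebra ::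
    "('k::field, 'h, 'm) bialgebra_scheme \<Rightarrow> ('k \<Rightarrow> 'l::field) \<Rightarrow> ('h \<Rightarrow> 'l \<Rightarrow> 'l) \<Rightarrow> bool"
  where "module_algebra H \<iota> \<rho> \<longleftrightarrow>
    (\<forall>h\<in>carrier H. \<forall>a b. \<rho> h (a + b) = \<rho> h a + \<rho> h b) \<and>
    (\<forall>h\<in>carrier H. \<forall>c a. \<rho> h (\<iota> c * a) = \<iota> c * \<rho> h a) \<and>
    (\<forall>h\<in>carrier H. \<forall>h'\<in>carrier H. \<forall>a. \<rho> (h \<oplus>\<^bsub>H\<^esub> h') a = \<rho> h a + \<rho> h' a) \<and>
    (\<forall>h\<in>carrier H. \<forall>c a. \<rho> (c \<odot>\<^bsub>H\<^esub> h) a = \<iota> c * \<rho> h a) \<and>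
    (\<forall>h\<in>carrier H. \<forall>h'\<in>carrier H. \<forall>a. \<rho> (h \<otimes>\<^bsub>H\<^esub> h') a = \<rho> h (\<rho> h' a)) \<and>
    (\<forall>a. \<rho> \<one>\<^bsub>H\<^esub> a = a) \<and>
    (\<forall>h\<in>carrier H. \<forall>t\<in>comult H h. \<forall>a b.
       \<rho> h (a * b) =
         (\<Sum>(u, v)\<in>Poly_Mapping.keys t. \<iota> (Poly_Mapping.lookup t (u, v)) * (\<rho> u a * \<rho> v b))) \<and>
    (\<forall>h\<in>carrier H. \<rho> h 1 = \<iota> (counit H h))"


section \<open>Free algebras\<close>

text \<open>
  Lists are made the free monoid, written additively, so that \<open>'x list \<Rightarrow>\<^sub>0 'k\<close> with the convolution
  product is the free associative unital \<open>'k\<close>-algebra on \<open>'x\<close>, and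
  \<open>'x list \<times> 'x list \<Rightarrow>\<^sub>0 'k\<close> is its tensor square as an algebra.
\<close>

instantiation list :: (type) monoid_add
begin

definition zero_list :: "'a list" where "zero_list = []"

definition plus_list :: "'a list \<Rightarrow> 'a list \<Rightarrow> 'a list" where "plus_list = (@)"

instance
  by standard (simp_all add: zero_list_def plus_list_def)

end

definition free_algebra :: "'x set \<Rightarrow> ('x list \<Rightarrow>\<^sub>0 'k::field) ring"
  where "free_algebra X =
    \<lparr>carrier = {f. Poly_Mapping.keys f \<subseteq> lists X}, monoid.mult = (*), one = 1, zero = 0, add = (+)\<rparr>"


section \<open>The Hopf algebra\<close>

definition unit_group :: "'k::field monoid"
  where "unit_group = \<lparr>carrier = - {0}, monoid.mult = (*), one = 1\<rparr>"

datatype 'g generator = Grp 'g | Skew nat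

abbreviation monomial :: "'x list \<Rightarrow> 'x list \<Rightarrow>\<^sub>0 'k::field"
  where "monomial u \<equiv> Poly_Mapping.single u 1"

definition hopf_free :: "('g, 'm) monoid_scheme \<Rightarrow> nat \<Rightarrow> ('g generator list \<Rightarrow>\<^sub>0 'k::field) ring"
  where "hopf_free G \<theta> = free_algebra (Grp ` carrier G \<union> Skew ` {1..\<theta>})"

definition hopf_relations ::
    "('g, 'm) monoid_scheme \<Rightarrow> nat \<Rightarrow> (nat \<Rightarrow> nat) \<Rightarrow> (nat \<Rightarrow> 'g \<Rightarrow> 'k::field)
      \<Rightarrow> ('g generator list \<Rightarrow>\<^sub>0 'k) set"
  where "hopf_relations G \<theta> n \<chi> =
    {monomial [Grp a, Grp b] - monomial [Grp (a \<otimes>\<^bsub>G\<^esub> b)] | a b. a \<in> carrier G \<and> b \<in> carrier G} \<union>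
    {monomial [Grp \<one>\<^bsub>G\<^esub>] - 1} \<union>
    {monomial [Skew i] ^ n i | i. i \<in> {1..\<theta>}} \<union>
    {monomial [Grp a, Skew i] - pm_scale (\<chi> i a) (monomial [Skew i, Grp a])
       | a i. a \<in> carrier G \<and> i \<in> {1..\<theta>}}"

definition hopf_ideal ::
    "('g, 'm) monoid_scheme \<Rightarrow> nat \<Rightarrow> (nat \<Rightarrow> nat) \<Rightarrow> (nat \<Rightarrow> 'g \<Rightarrow> 'k::field)
      \<Rightarrow> ('g generator list \<Rightarrow>\<^sub>0 'k) set"
  where "hopf_ideal G \<theta> n \<chi> = Idl\<^bsub>hopf_free G \<theta>\<^esub> (hopf_relations G \<theta> n \<chi>)"

definition hopf_class ::
    "('g, 'm) monoid_scheme \<Rightarrow> nat \<Rightarrow> (nat \<Rightarrow> nat) \<Rightarrow> (nat \<Rightarrow> 'g \<Rightarrow> 'k::field)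
      \<Rightarrow> ('g generator list \<Rightarrow>\<^sub>0 'k) \<Rightarrow> ('g generator list \<Rightarrow>\<^sub>0 'k) set"
  where "hopf_class G \<theta> n \<chi> f = hopf_ideal G \<theta> n \<chi> +>\<^bsub>hopf_free G \<theta>\<^esub> f"

text \<open>
  Comultiplication and counit are first defined on the free algebra, as the algebra homomorphisms
  with \<open>\<Delta>(g) = g \<otimes> g\<close>, \<open>\<Delta>(x\<^sub>i) = g\<^sub>i \<otimes> x\<^sub>i + x\<^sub>i \<otimes> 1\<close>, \<open>\<epsilon>(g) = 1\<close>, \<open>\<epsilon>(x\<^sub>i) = 0\<close>; here
  a pair of words \<open>(u, v)\<close> stands for \<open>u \<otimes> v\<close>.
\<close>

fun gen_comult ::
    "(nat \<Rightarrow> 'g) \<Rightarrow> 'g generator \<Rightarrow> ('g generator list \<times> 'g generator list \<Rightarrow>\<^sub>0 'k::field)"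
  where
    "gen_comult g (Grp a) = Poly_Mapping.single ([Grp a], [Grp a]) 1"
  | "gen_comult g (Skew i) =
       Poly_Mapping.single ([Grp (g i)], [Skew i]) 1 + Poly_Mapping.single ([Skew i], []) 1"

fun gen_counit :: "'g generator \<Rightarrow> 'k::field"
  where
    "gen_counit (Grp a) = 1"
  | "gen_counit (Skew i) = 0"

definition free_comult ::
    "(nat \<Rightarrow> 'g) \<Rightarrow> ('g generator list \<Rightarrow>\<^sub>0 'k::field)
      \<Rightarrow> ('g generator list \<times> 'g generator list \<Rightarrow>\<^sub>0 'k)"
  where "free_comult g f =
    (\<Sum>u\<in>Poly_Mapping.keys f.
       pm_scale (Poly_Mapping.lookup f u) (prod_list (map (gen_comult g) u)))"

definition free_counit :: "('g generator list \<Rightarrow>\<^sub>0 'k::field) \<Rightarrow> 'k"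
  where "free_counit f =
    (\<Sum>u\<in>Poly_Mapping.keys f. Poly_Mapping.lookup f u * prod_list (map gen_counit u))"

definition hopf_algebra_as_module ::
    "('g, 'm) monoid_scheme \<Rightarrow> nat \<Rightarrow> (nat \<Rightarrow> nat) \<Rightarrow> (nat \<Rightarrow> 'g \<Rightarrow> 'k::field)
      \<Rightarrow> ('k, ('g generator list \<Rightarrow>\<^sub>0 'k) set) module"
  where "hopf_algebra_as_module G \<theta> n \<chi> =
    (let Q = hopf_free G \<theta> Quot hopf_ideal G \<theta> n \<chi>
     in \<lparr>carrier = carrier Q, monoid.mult = monoid.mult Q, one = one Q, zero = zero Q, add = add Q,
         module.smult = (\<lambda>c C. hopf_class G \<theta> n \<chi> (Poly_Mapping.single [] c) \<otimes>\<^bsub>Q\<^esub> C)\<rparr>)"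

text \<open>
  \<open>H(G, g\<^sub>1, \<dots>, g\<^sub>\<theta>, \<chi>\<^sub>1, \<dots>, \<chi>\<^sub>\<theta>)\<close>. The argument \<open>n\<close> carries the exponents \<open>n\<^sub>i\<close>,
  the common order of \<open>g\<^sub>i\<close> and \<open>\<chi>\<^sub>i(g\<^sub>i)\<close>; under that hypothesis the two maps above descend to
  the quotient by the ideal of relations.
\<close>

definition hopf_algebra ::
    "('g, 'm) monoid_scheme \<Rightarrow> nat \<Rightarrow> (nat \<Rightarrow> nat) \<Rightarrow> (nat \<Rightarrow> 'g) \<Rightarrow> (nat \<Rightarrow> 'g \<Rightarrow> 'k::field)
      \<Rightarrow> ('k, ('g generator list \<Rightarrow>\<^sub>0 'k) set) bialgebra"
  where "hopf_algebra G \<theta> n g \<chi> =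
    (let M = hopf_algebra_as_module G \<theta> n \<chi>; cl = hopf_class G \<theta> n \<chi>
     in \<lparr>carrier = carrier M, monoid.mult = monoid.mult M, one = one M, zero = zero M, add = add M,
         module.smult = module.smult M,
         comult = (\<lambda>C. \<Union>f\<in>C. tensor_class M
           (\<Sum>(u, v)\<in>Poly_Mapping.keys (free_comult g f).
              Poly_Mapping.single (cl (monomial u), cl (monomial v))
                (Poly_Mapping.lookup (free_comult g f) (u, v)))),
         counit = (\<lambda>C. the_elem (free_counit ` C))\<rparr>)"

definition hopf_grp ::
    "('g, 'm) monoid_scheme \<Rightarrow> nat \<Rightarrow> (nat \<Rightarrow> nat) \<Rightarrow> (nat \<Rightarrow> 'g \<Rightarrow> 'k::field)
      \<Rightarrow> 'g \<Rightarrow> ('g generator list \<Rightarrow>\<^sub>0 'k) set"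
  where "hopf_grp G \<theta> n \<chi> a = hopf_class G \<theta> n \<chi> (monomial [Grp a])"

definition hopf_x ::
    "('g, 'm) monoid_scheme \<Rightarrow> nat \<Rightarrow> (nat \<Rightarrow> nat) \<Rightarrow> (nat \<Rightarrow> 'g \<Rightarrow> 'k::field)
      \<Rightarrow> nat \<Rightarrow> ('g generator list \<Rightarrow>\<^sub>0 'k) set"
  where "hopf_x G \<theta> n \<chi> i = hopf_class G \<theta> n \<chi> (monomial [Skew i])"


section \<open>Extensions of the group action\<close>

definition extends_action ::
    "('g, 'm) monoid_scheme \<Rightarrow> nat \<Rightarrow> (nat \<Rightarrow> nat) \<Rightarrow> (nat \<Rightarrow> 'g) \<Rightarrow> (nat \<Rightarrow> 'g \<Rightarrow> 'k::field)
      \<Rightarrow> ('k \<Rightarrow> 'l::field) \<Rightarrow> ('g \<Rightarrow> 'l \<Rightarrow> 'l)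
      \<Rightarrow> (('g generator list \<Rightarrow>\<^sub>0 'k) set \<Rightarrow> 'l \<Rightarrow> 'l) \<Rightarrow> bool"
  where "extends_action G \<theta> n g \<chi> \<iota> act \<rho> \<longleftrightarrow>
    module_algebra (hopf_algebra G \<theta> n g \<chi>) \<iota> \<rho> \<and>
    (\<forall>a\<in>carrier G. \<forall>l. \<rho> (hopf_grp G \<theta> n \<chi> a) l = act a l)"

definition semi_invariants ::
    "('g, 'm) monoid_scheme \<Rightarrow> nat \<Rightarrow> (nat \<Rightarrow> 'g \<Rightarrow> 'k::field)
      \<Rightarrow> ('k \<Rightarrow> 'l::field) \<Rightarrow> ('g \<Rightarrow> 'l \<Rightarrow> 'l) \<Rightarrow> (nat \<Rightarrow> 'l) \<Rightarrow> bool"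
  where "semi_invariants G \<theta> \<chi> \<iota> act w \<longleftrightarrow>
    (\<forall>i\<in>{1..\<theta>}. \<forall>a\<in>carrier G. act a (w i) = \<iota> (\<chi> i a) * w i)"

definition given_by_formula ::
    "('g, 'm) monoid_scheme \<Rightarrow> nat \<Rightarrow> (nat \<Rightarrow> nat) \<Rightarrow> (nat \<Rightarrow> 'g) \<Rightarrow> (nat \<Rightarrow> 'g \<Rightarrow> 'k::field)
      \<Rightarrow> ('g \<Rightarrow> 'l::field \<Rightarrow> 'l)
      \<Rightarrow> (('g generator list \<Rightarrow>\<^sub>0 'k) set \<Rightarrow> 'l \<Rightarrow> 'l) \<Rightarrow> (nat \<Rightarrow> 'l) \<Rightarrow> bool"
  where "given_by_formula G \<theta> n g \<chi> act \<rho> w \<longleftrightarrow>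
    (\<forall>i\<in>{1..\<theta>}. \<forall>l. \<rho> (hopf_x G \<theta> n \<chi> i) l = w i * (l - act (g i) l))"

text \<open>Characters are compared on \<open>carrier G\<close> only.\<close>

definition index_set ::
    "('g, 'm) monoid_scheme \<Rightarrow> nat \<Rightarrow> (nat \<Rightarrow> 'g) \<Rightarrow> (nat \<Rightarrow> 'g \<Rightarrow> 'k) \<Rightarrow> 'g \<Rightarrow> ('g \<Rightarrow> 'k) \<Rightarrow> nat set"
  where "index_set G \<theta> g \<chi> a \<psi> = {i\<in>{1..\<theta>}. g i = a \<and> (\<forall>b\<in>carrier G. \<chi> i b = \<psi> b)}"

text \<open>Linear independence of a family: repeated members make it dependent.\<close>

definition independent_family ::
    "('k::field \<Rightarrow> 'v::ab_group_add \<Rightarrow> 'v) \<Rightarrow> 'i set \<Rightarrow> ('i \<Rightarrow> 'v) \<Rightarrow> bool"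
  where "independent_family scale I v \<longleftrightarrow> inj_on v I \<and> \<not> module.dependent scale (v ` I)"

definition field_scale :: "('k::field \<Rightarrow> 'l::field) \<Rightarrow> 'k \<Rightarrow> 'l \<Rightarrow> 'l"
  where "field_scale \<iota> c a = \<iota> c * a"

definition operator_scale :: "('k::field \<Rightarrow> 'l::field) \<Rightarrow> 'k \<Rightarrow> ('l \<Rightarrow> 'l) \<Rightarrow> 'l \<Rightarrow> 'l"
  where "operator_scale \<iota> c f = (\<lambda>a. \<iota> c * f a)"

end

theory Submission
  imports Defs
begin

text \<open>
  An element \<open>x\<close> with \<open>\<Delta>(x) = g \<otimes> x + x \<otimes> 1\<close> acts on \<open>L\<close> as a skew derivation,
  \<open>x(ab) = g(a) x(b) + x(a) b\<close>. Because \<open>L\<close> is commutative, expanding \<open>x(ab) = x(ba)\<close> gives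
  \<open>x(b) (a - g(a)) = x(a) (b - g(b))\<close>; as \<open>g \<noteq> 1\<close> moves some \<open>a\<close>, the operator is \<open>w (1 - g)\<close> with
  \<open>w = x(a) / (a - g(a))\<close> (\<open>skew_derivation_inner\<close>). The relation \<open>h x = \<chi>(h) x h\<close> then says that \<open>w\<close>
  has weight \<open>\<chi>\<close> (\<open>extension_given_by_formula\<close>).

  Conversely, given semi-invariants \<open>w\<^sub>i\<close>, let the free algebra act through the formula. The only
  relation that is not immediate is \<open>x\<^sub>i\<^sup>n = 0\<close>, where \<open>n = n\<^sub>i\<close>. Write \<open>g = g\<^sub>i\<close>, \<open>w = w\<^sub>i\<close>, and let
  \<open>q = \<chi>\<^sub>i(g)\<close>, a primitive \<open>n\<close>-th root of unity. Moving the factors \<open>w\<close> to the left turns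
  \<open>(w (1 - g))\<^sup>n\<close> into \<open>w\<^sup>n \<Prod>\<^sub>j (1 - q\<^sup>j g)\<close>, which is zero on every eigenvector of \<open>g\<close>,
  and the eigenvectors span \<open>L\<close> (\<open>skew_op_nilpotent\<close>). So the action descends to the quotient. Compatibility with the
  comultiplication is multiplicative in the word and linear in the tensor, hence has to be checked on
  generators only (\<open>word_op_comult\<close>, \<open>lin_ext_tensor_null\<close>). An action is determined by its values on
  the generators (\<open>extension_unique\<close>).

  If all \<open>g\<^sub>i\<close> equal \<open>g\<close>, then \<open>\<Sum> c\<^sub>i x\<^sub>i\<close> is \<open>(\<Sum> c\<^sub>i w\<^sub>i) (1 - g)\<close>, whence the criterion for linear
  independence (\<open>independent_operators_iff\<close>). It can be met: each weight occurs in \<open>L\<close> by Dedekind's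
  independence of automorphisms (\<open>exists_semi_invariant\<close>), and a nonzero \<open>y\<^sub>0\<close> of weight \<open>\<chi>\<^sub>1\<close> is moved
  by \<open>g\<^sub>1\<close>, so it is not in the algebraically closed field \<open>k\<close> and is therefore transcendental over
  it. The powers of \<open>y\<^sub>0\<close> whose exponents are multiples of the order of \<open>G\<close> are invariant, so they
  supply infinitely many independent semi-invariants of each weight
  (\<open>exists_independent_semi_invariants\<close>).
\<close>

text \<open>The simplifier would turn \<open>{1..\<theta>}\<close> into \<open>{Suc 0..\<theta>}\<close>, which no longer matches the hypotheses on indices.\<close>

declare One_nat_def [simp del]

section \<open>Linear extension to finitely supported functions\<close>

definition lin_ext :: "('k::field \<Rightarrow> 'l::field) \<Rightarrow> ('a \<Rightarrow> 'l) \<Rightarrow> ('a \<Rightarrow>\<^sub>0 'k) \<Rightarrow> 'l"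
  where "lin_ext \<iota> \<phi> t = (\<Sum>p\<in>Poly_Mapping.keys t. \<iota> (Poly_Mapping.lookup t p) * \<phi> p)"

lemma poly_mapping_as_sum:
  "f = (\<Sum>u\<in>Poly_Mapping.keys f. Poly_Mapping.single u (Poly_Mapping.lookup f u))"
proof (rule poly_mapping_eqI)
  fix k
  have "Poly_Mapping.lookup (\<Sum>u\<in>Poly_Mapping.keys f. Poly_Mapping.single u (Poly_Mapping.lookup f u)) k
      = (\<Sum>u\<in>Poly_Mapping.keys f. if u = k then Poly_Mapping.lookup f u else 0)"
    by (simp add: lookup_sum lookup_single when_def)
  also have "\<dots> = Poly_Mapping.lookup f k"
    by (simp add: not_in_keys_iff_lookup_eq_zero)
  finally show "Poly_Mapping.lookup f k =
      Poly_Mapping.lookup (\<Sum>u\<in>Poly_Mapping.keys f. Poly_Mapping.single u (Poly_Mapping.lookup f u)) k"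
    by simp
qed

lemma lookup_pm_scale [simp]: "Poly_Mapping.lookup (pm_scale c t) p = c * Poly_Mapping.lookup t p"
  for c :: "'k::comm_ring_1"
  by (simp add: Poly_Mapping.map.rep_eq when_def)

lemma module_pm_scale: "Modules.module (pm_scale :: 'k::field \<Rightarrow> ('a \<Rightarrow>\<^sub>0 'k) \<Rightarrow> _)"
  by unfold_locales (auto intro!: poly_mapping_eqI simp: lookup_add algebra_simps)

lemma pm_scale_conv_mult: "pm_scale c f = Poly_Mapping.single [] c * f"
  for f :: "'x list \<Rightarrow>\<^sub>0 'k::comm_ring_1"
  by (metis mult_map_scale_conv_mult zero_list_def)

locale field_extension =
  fixes \<iota> :: "'k::field \<Rightarrow> 'l::field"
  assumes embedding: "field_embedding \<iota>"
begin

lemma emb_1 [simp]: "\<iota> 1 = 1"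
  and emb_add: "\<iota> (a + b) = \<iota> a + \<iota> b"
  and emb_mult: "\<iota> (a * b) = \<iota> a * \<iota> b"
  using embedding by (auto simp: field_embedding_def)

lemma emb_0 [simp]: "\<iota> 0 = 0"
  by (metis add.right_neutral add_left_cancel emb_add)

lemma emb_minus: "\<iota> (- a) = - \<iota> a"
  using emb_add[of a "- a"] by (simp add: eq_neg_iff_add_eq_0 add.commute)

lemma emb_diff: "\<iota> (a - b) = \<iota> a - \<iota> b"
  using emb_add[of a "- b"] by (simp add: emb_minus)

lemma emb_eq_0_iff [simp]: "\<iota> a = 0 \<longleftrightarrow> a = 0"
proof
  assume "\<iota> a = 0"
  show "a = 0"
  proof (rule ccontr)
    assume "a \<noteq> 0"
    then have "\<iota> (a * inverse a) = 1"
      by simp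
    with \<open>\<iota> a = 0\<close> show False
      by (simp add: emb_mult del: right_inverse)
  qed
qed simp

lemma emb_eq_iff [simp]: "\<iota> a = \<iota> b \<longleftrightarrow> a = b"
  using emb_eq_0_iff[of "a - b"] unfolding emb_diff by simp

lemma emb_eq_1_iff [simp]: "\<iota> a = 1 \<longleftrightarrow> a = 1"
  using emb_eq_iff[of a 1] by simp

lemma emb_power: "\<iota> (a ^ m) = \<iota> a ^ m"
  by (induction m) (simp_all add: emb_mult)

lemma emb_sum: "\<iota> (sum f A) = (\<Sum>i\<in>A. \<iota> (f i))"
  by (induction A rule: infinite_finite_induct) (simp_all add: emb_add)

lemma lin_ext_superset:
  assumes "finite A" "Poly_Mapping.keys t \<subseteq> A"
  shows "lin_ext \<iota> \<phi> t = (\<Sum>p\<in>A. \<iota> (Poly_Mapping.lookup t p) * \<phi> p)"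
  unfolding lin_ext_def
  by (rule sum.mono_neutral_left) (use assms in \<open>auto simp: not_in_keys_iff_lookup_eq_zero\<close>)

lemma lin_ext_0 [simp]: "lin_ext \<iota> \<phi> 0 = 0"
  by (simp add: lin_ext_def)

lemma lin_ext_add: "lin_ext \<iota> \<phi> (s + t) = lin_ext \<iota> \<phi> s + lin_ext \<iota> \<phi> t"
proof -
  have "finite (Poly_Mapping.keys s \<union> Poly_Mapping.keys t)"
    by simp
  note sup = lin_ext_superset[OF this]
  show ?thesis
    using Poly_Mapping.keys_add[of s t]
    by (simp add: sup lookup_add emb_add distrib_right sum.distrib)
qed

lemma lin_ext_single [simp]: "lin_ext \<iota> \<phi> (Poly_Mapping.single p c) = \<iota> c * \<phi> p"
  by (subst lin_ext_superset[of "{p}"]) (auto simp: lookup_single when_def split: if_splits)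

lemma lin_ext_minus: "lin_ext \<iota> \<phi> (- t) = - lin_ext \<iota> \<phi> t"
  using lin_ext_add[of \<phi> t "- t"] by (simp add: eq_neg_iff_add_eq_0 add.commute)

lemma lin_ext_diff: "lin_ext \<iota> \<phi> (s - t) = lin_ext \<iota> \<phi> s - lin_ext \<iota> \<phi> t"
  using lin_ext_add[of \<phi> s "- t"] by (simp add: lin_ext_minus)

lemma lin_ext_sum: "lin_ext \<iota> \<phi> (sum F A) = (\<Sum>i\<in>A. lin_ext \<iota> \<phi> (F i))"
  by (induction A rule: infinite_finite_induct) (simp_all add: lin_ext_add)

lemma lin_ext_scale: "lin_ext \<iota> \<phi> (pm_scale c t) = \<iota> c * lin_ext \<iota> \<phi> t"
proof -
  have "Poly_Mapping.keys (pm_scale c t) \<subseteq> Poly_Mapping.keys t"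
    by (auto simp: in_keys_iff)
  then show ?thesis
    by (simp add: lin_ext_superset[of "Poly_Mapping.keys t"] emb_mult sum_distrib_left mult.assoc)
qed

lemma lin_ext_cong:
  assumes "\<And>p. p \<in> Poly_Mapping.keys t \<Longrightarrow> \<phi> p = \<psi> p"
  shows "lin_ext \<iota> \<phi> t = lin_ext \<iota> \<psi> t"
  using assms by (simp add: lin_ext_def)

text \<open>
  The functional \<open>\<phi>\<close> on a monoid algebra, evaluated on a product, is computed one factor at a time.
  This turns multiplicativity statements on the free algebra and on its tensor square into statements
  about words.
\<close>

lemma lin_ext_mult:
  fixes f h :: "'a::monoid_add \<Rightarrow>\<^sub>0 'k"
  shows "lin_ext \<iota> \<phi> (f * h) = lin_ext \<iota> (\<lambda>u. lin_ext \<iota> (\<lambda>v. \<phi> (u + v)) h) f"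
proof -
  have "f * h = (\<Sum>u\<in>Poly_Mapping.keys f. \<Sum>v\<in>Poly_Mapping.keys h.
      Poly_Mapping.single (u + v) (Poly_Mapping.lookup f u * Poly_Mapping.lookup h v))"
    by (subst (1) poly_mapping_as_sum[of f], subst (1) poly_mapping_as_sum[of h])
      (simp add: sum_product mult_single)
  then show ?thesis
    by (simp add: lin_ext_sum emb_mult)
      (simp add: lin_ext_def sum_distrib_left mult.assoc)
qed

definition linear_op :: "('l \<Rightarrow> 'l) \<Rightarrow> bool"
  where "linear_op F \<longleftrightarrow> (\<forall>a b. F (a + b) = F a + F b) \<and> (\<forall>c a. F (\<iota> c * a) = \<iota> c * F a)"

lemma linear_op_0: "linear_op F \<Longrightarrow> F 0 = 0"
  unfolding linear_op_def by (metis emb_0 mult_zero_left)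

lemma linear_op_diff: "linear_op F \<Longrightarrow> F (a - b) = F a - F b"
  unfolding linear_op_def by (metis add_diff_cancel diff_add_cancel)

lemma linear_op_sum: "linear_op F \<Longrightarrow> F (sum f A) = (\<Sum>i\<in>A. F (f i))"
  by (induction A rule: infinite_finite_induct) (simp_all add: linear_op_0, simp add: linear_op_def)

lemma linear_op_lin_ext:
  "linear_op F \<Longrightarrow> F (lin_ext \<iota> \<phi> t) = lin_ext \<iota> (\<lambda>p. F (\<phi> p)) t"
  by (simp add: lin_ext_def linear_op_sum) (simp add: linear_op_def)

lemma linear_op_lin_ext_param:
  assumes "\<And>p. p \<in> Poly_Mapping.keys t \<Longrightarrow> linear_op (\<phi> p)"
  shows "linear_op (\<lambda>a. lin_ext \<iota> (\<lambda>p. \<phi> p a) t)"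
  using assms unfolding linear_op_def lin_ext_def
  by (simp add: distrib_left sum.distrib sum_distrib_left mult.left_commute)

lemma linear_op_foldr: "(\<And>x. x \<in> set u \<Longrightarrow> linear_op (T x)) \<Longrightarrow> linear_op (foldr T u)"
  by (induction u) (auto simp: linear_op_def)

end

section \<open>The free algebra\<close>

lemma carrier_free_algebra: "f \<in> carrier (free_algebra X) \<longleftrightarrow> Poly_Mapping.keys f \<subseteq> lists X"
  by (simp add: free_algebra_def)

lemma free_algebra_ops [simp]:
  "monoid.mult (free_algebra X) = (*)" "one (free_algebra X) = 1"
  "zero (free_algebra X) = 0" "add (free_algebra X) = (+)"
  by (simp_all add: free_algebra_def)

lemma free_algebra_uminus: "f \<in> carrier (free_algebra X) \<Longrightarrow> - f \<in> carrier (free_algebra X)"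
  by (simp add: carrier_free_algebra in_keys_iff subset_iff)

lemma free_algebra_closed:
  assumes "f \<in> carrier (free_algebra X)" "h \<in> carrier (free_algebra X)"
  shows "f + h \<in> carrier (free_algebra X)" "f * h \<in> carrier (free_algebra X)"
    "f - h \<in> carrier (free_algebra X)"
proof -
  show "f + h \<in> carrier (free_algebra X)"
    using assms Poly_Mapping.keys_add[of f h] by (auto simp: carrier_free_algebra)
  show "f * h \<in> carrier (free_algebra X)"
    using assms Poly_Mapping.keys_mult[of f h]
    by (fastforce simp: carrier_free_algebra plus_list_def)
  show "f - h \<in> carrier (free_algebra X)"
    using assms Poly_Mapping.keys_diff[of f h] by (auto simp: carrier_free_algebra)
qed

lemma free_algebra_single: "u \<in> lists X \<Longrightarrow> Poly_Mapping.single u c \<in> carrier (free_algebra X)"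
  by (auto simp: carrier_free_algebra)

lemma free_algebra_consts: "0 \<in> carrier (free_algebra X)" "1 \<in> carrier (free_algebra X)"
  by (auto simp: carrier_free_algebra zero_list_def)

lemma free_algebra_power:
  "f \<in> carrier (free_algebra X) \<Longrightarrow> f ^ m \<in> carrier (free_algebra X)"
  by (induction m) (simp_all add: free_algebra_consts free_algebra_closed)

lemma ring_free_algebra: "ring (free_algebra X :: ('x list \<Rightarrow>\<^sub>0 'k::field) ring)"
proof (rule ringI)
  show "abelian_group (free_algebra X :: ('x list \<Rightarrow>\<^sub>0 'k) ring)"
  proof (rule abelian_groupI)
    fix f :: "'x list \<Rightarrow>\<^sub>0 'k" assume f: "f \<in> carrier (free_algebra X)"
    show "\<exists>h\<in>carrier (free_algebra X). h \<oplus>\<^bsub>free_algebra X\<^esub> f = \<zero>\<^bsub>free_algebra X\<^esub>"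
      by (intro bexI[of _ "- f"]) (simp_all add: free_algebra_uminus[OF f])
  qed (simp_all add: free_algebra_closed free_algebra_consts algebra_simps)
  show "monoid (free_algebra X :: ('x list \<Rightarrow>\<^sub>0 'k) ring)"
    by (rule monoidI) (simp_all add: free_algebra_closed free_algebra_consts mult.assoc)
qed (simp_all add: algebra_simps)

lemma free_algebra_a_minus:
  fixes f h :: "'x list \<Rightarrow>\<^sub>0 'k::field"
  assumes "f \<in> carrier (free_algebra X)" "h \<in> carrier (free_algebra X)"
  shows "f \<ominus>\<^bsub>free_algebra X\<^esub> h = f - h"
proof -
  interpret ring "free_algebra X :: ('x list \<Rightarrow>\<^sub>0 'k) ring"
    by (rule ring_free_algebra)
  have "\<ominus>\<^bsub>free_algebra X\<^esub> h = - h"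
    using assms by (intro minus_equality) (simp_all add: free_algebra_uminus)
  then show ?thesis
    by (simp add: a_minus_def)
qed

section \<open>Group actions and the quotient presenting the Hopf algebra\<close>

locale field_action = field_extension \<iota> for \<iota> :: "'k::field \<Rightarrow> 'l::field" +
  fixes G :: "('g, 'm) monoid_scheme" and act :: "'g \<Rightarrow> 'l \<Rightarrow> 'l"
  assumes comm: "comm_group G" and fin: "finite (carrier G)"
    and faithful: "faithful_action G UNIV act"
    and automorphism: "\<And>a. a \<in> carrier G \<Longrightarrow> algebra_automorphism \<iota> (act a)"
begin

sublocale comm_group G
  by (rule comm)

lemma act_add: "a \<in> carrier G \<Longrightarrow> act a (l + m) = act a l + act a m"
  and act_mult: "a \<in> carrier G \<Longrightarrow> act a (l * m) = act a l * act a m"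
  and act_emb [simp]: "a \<in> carrier G \<Longrightarrow> act a (\<iota> c) = \<iota> c"
  using automorphism by (auto simp: algebra_automorphism_def)

lemma act_1 [simp]: "a \<in> carrier G \<Longrightarrow> act a 1 = 1"
  using act_emb[of a 1] by simp

lemma act_compose:
  "a \<in> carrier G \<Longrightarrow> b \<in> carrier G \<Longrightarrow> act (a \<otimes>\<^bsub>G\<^esub> b) l = act a (act b l)"
  using group_action.composition_rule[OF faithful_action.axioms(1)[OF faithful]] by simp

lemma act_one [simp]: "act \<one>\<^bsub>G\<^esub> l = l"
  using group_action.id_eq_one[OF faithful_action.axioms(1)[OF faithful]] by (metis UNIV_I restrict_apply)

lemma linear_op_act: "a \<in> carrier G \<Longrightarrow> linear_op (act a)"
  by (simp add: linear_op_def act_add act_mult)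

lemma act_0 [simp]: "a \<in> carrier G \<Longrightarrow> act a 0 = 0"
  by (simp add: linear_op_0 linear_op_act)

lemma act_diff: "a \<in> carrier G \<Longrightarrow> act a (l - m) = act a l - act a m"
  by (simp add: linear_op_diff linear_op_act)

lemma act_sum: "a \<in> carrier G \<Longrightarrow> act a (sum f A) = (\<Sum>i\<in>A. act a (f i))"
  by (simp add: linear_op_sum linear_op_act)

lemma act_power: "a \<in> carrier G \<Longrightarrow> act a (l ^ m) = act a l ^ m"
  by (induction m) (simp_all add: act_mult)

lemma act_nat_pow:
  "a \<in> carrier G \<Longrightarrow> act (a [^]\<^bsub>G\<^esub> (m::nat)) l = (act a ^^ m) l"
  by (induction m arbitrary: l) (simp_all add: act_compose funpow_swap1)

lemma act_inj_on: "inj_on act (carrier G)"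
  using faithful_action.faithful[OF faithful] .

lemma act_commute:
  "a \<in> carrier G \<Longrightarrow> b \<in> carrier G \<Longrightarrow> act a (act b l) = act b (act a l)"
  by (metis act_compose m_comm)

lemma act_moves:
  assumes "a \<in> carrier G" "a \<noteq> \<one>\<^bsub>G\<^esub>"
  obtains l where "act a l \<noteq> l"
proof -
  have "act a \<noteq> act \<one>\<^bsub>G\<^esub>"
    using act_inj_on assms by (auto dest: inj_onD)
  then obtain l where "act a l \<noteq> act \<one>\<^bsub>G\<^esub> l"
    by (auto simp: fun_eq_iff)
  then show thesis
    using that by simp
qed

end

locale hopf_data = field_action \<iota> G act
  for \<iota> :: "'k::{alg_closed_field, field_char_0} \<Rightarrow> 'l::field" and G :: "('g, 'm) monoid_scheme" and act +
  fixes \<theta> :: nat and n :: "nat \<Rightarrow> nat" and g :: "nat \<Rightarrow> 'g" and \<chi> :: "nat \<Rightarrow> 'g \<Rightarrow> 'k"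
  assumes g_closed: "\<And>i. i \<in> {1..\<theta>} \<Longrightarrow> g i \<in> carrier G"
    and \<chi>_hom: "\<And>i. i \<in> {1..\<theta>} \<Longrightarrow> \<chi> i \<in> hom G unit_group"
    and n_ge_2: "\<And>i. i \<in> {1..\<theta>} \<Longrightarrow> n i \<ge> 2"
    and ord_g: "\<And>i. i \<in> {1..\<theta>} \<Longrightarrow> group.ord G (g i) = n i"
    and ord_\<chi>g: "\<And>i. i \<in> {1..\<theta>} \<Longrightarrow> group.ord unit_group (\<chi> i (g i)) = n i"
begin

abbreviation gens :: "'g generator set"
  where "gens \<equiv> Grp ` carrier G \<union> Skew ` {1..\<theta>}"

abbreviation free_alg :: "('g generator list \<Rightarrow>\<^sub>0 'k) ring"
  where "free_alg \<equiv> free_algebra gens"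

abbreviation rels :: "('g generator list \<Rightarrow>\<^sub>0 'k) set"
  where "rels \<equiv> hopf_relations G \<theta> n \<chi>"

abbreviation rel_ideal :: "('g generator list \<Rightarrow>\<^sub>0 'k) set"
  where "rel_ideal \<equiv> hopf_ideal G \<theta> n \<chi>"

abbreviation cl :: "('g generator list \<Rightarrow>\<^sub>0 'k) \<Rightarrow> ('g generator list \<Rightarrow>\<^sub>0 'k) set"
  where "cl \<equiv> hopf_class G \<theta> n \<chi>"

abbreviation hopf :: "('k, ('g generator list \<Rightarrow>\<^sub>0 'k) set) bialgebra"
  where "hopf \<equiv> hopf_algebra G \<theta> n g \<chi>"

abbreviation hopf_mod :: "('k, ('g generator list \<Rightarrow>\<^sub>0 'k) set) module"
  where "hopf_mod \<equiv> hopf_algebra_as_module G \<theta> n \<chi>"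

sublocale free_alg: ring free_alg
  by (rule ring_free_algebra)

lemma rels_closed: "rels \<subseteq> carrier free_alg"
  unfolding hopf_relations_def
  by (auto simp: pm_scale_conv_mult
      intro!: free_algebra_closed free_algebra_power free_algebra_single free_algebra_consts)

lemma ideal_rel_ideal: "ideal rel_ideal free_alg"
  unfolding hopf_ideal_def hopf_free_def by (rule free_alg.genideal_ideal[OF rels_closed])

sublocale rel: ideal rel_ideal free_alg
  by (rule ideal_rel_ideal)

lemma rels_subset: "rels \<subseteq> rel_ideal"
  unfolding hopf_ideal_def hopf_free_def by (rule free_alg.genideal_self[OF rels_closed])

lemma rel_ideal_minimal: "ideal I free_alg \<Longrightarrow> rels \<subseteq> I \<Longrightarrow> rel_ideal \<subseteq> I"
  unfolding hopf_ideal_def hopf_free_def by (rule free_alg.genideal_minimal)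

lemma cl_eq_coset: "cl f = rel_ideal +>\<^bsub>free_alg\<^esub> f"
  by (simp add: hopf_class_def hopf_free_def)

lemma mem_cl_iff: "f' \<in> cl f \<longleftrightarrow> f' - f \<in> rel_ideal"
  by (auto simp: cl_eq_coset a_r_coset_def') (metis diff_add_cancel)

lemma cl_self: "f \<in> cl f"
  using rel.zero_closed by (simp add: mem_cl_iff)

lemma cl_subset: "f \<in> carrier free_alg \<Longrightarrow> cl f \<subseteq> carrier free_alg"
  using rel.Icarr free_algebra_closed(1) by (metis diff_add_cancel mem_cl_iff subsetI)

lemma cl_eqI:
  assumes "f \<in> carrier free_alg" "h \<in> carrier free_alg" "f - h \<in> rel_ideal"
  shows "cl f = cl h"
  using free_alg.quotient_eq_iff_same_a_r_cos[OF ideal_rel_ideal assms(1,2)] assms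
  by (simp add: free_algebra_a_minus cl_eq_coset)

lemma carrier_hopf_mod: "carrier hopf_mod = cl ` carrier free_alg"
  by (auto simp: hopf_algebra_as_module_def Let_def FactRing_def A_RCOSETS_def' cl_eq_coset hopf_free_def)

lemma hopf_mod_ops:
  "f \<in> carrier free_alg \<Longrightarrow> h \<in> carrier free_alg \<Longrightarrow> cl f \<oplus>\<^bsub>hopf_mod\<^esub> cl h = cl (f + h)"
  "f \<in> carrier free_alg \<Longrightarrow> h \<in> carrier free_alg \<Longrightarrow> cl f \<otimes>\<^bsub>hopf_mod\<^esub> cl h = cl (f * h)"
  "\<one>\<^bsub>hopf_mod\<^esub> = cl 1"
  "f \<in> carrier free_alg \<Longrightarrow> c \<odot>\<^bsub>hopf_mod\<^esub> cl f = cl (pm_scale c f)"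
  using rel.a_rcos_sum[of f h] rel.rcoset_mult_add[of f h]
    rel.rcoset_mult_add[of "Poly_Mapping.single [] c" f] free_algebra_single[of "[]" gens c]
  by (auto simp: hopf_algebra_as_module_def Let_def FactRing_def cl_eq_coset hopf_free_def
      pm_scale_conv_mult)

lemma hopf_eq_hopf_mod:
  "carrier hopf = carrier hopf_mod" "monoid.mult hopf = monoid.mult hopf_mod"
  "one hopf = one hopf_mod" "add hopf = add hopf_mod" "module.smult hopf = module.smult hopf_mod"
  by (simp_all add: hopf_algebra_def Let_def)

text \<open>The representative of \<open>\<Delta>(f)\<close> in the tensor square of the quotient that is read off the free algebra.\<close>

definition comult_rep :: "('g generator list \<Rightarrow>\<^sub>0 'k)
    \<Rightarrow> (('g generator list \<Rightarrow>\<^sub>0 'k) set \<times> ('g generator list \<Rightarrow>\<^sub>0 'k) set \<Rightarrow>\<^sub>0 'k)"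
  where "comult_rep f = (\<Sum>(u, v)\<in>Poly_Mapping.keys (free_comult g f).
      Poly_Mapping.single (cl (monomial u), cl (monomial v))
        (Poly_Mapping.lookup (free_comult g f) (u, v)))"

lemma comult_hopf: "comult hopf C = (\<Union>f\<in>C. tensor_class hopf_mod (comult_rep f))"
  by (simp add: hopf_algebra_def Let_def comult_rep_def)

lemma counit_hopf: "counit hopf C = the_elem (free_counit ` C)"
  by (simp add: hopf_algebra_def Let_def)

end

section \<open>Actions of the Hopf algebra come from the formula\<close>

context field_extension
begin

lemma tensor_eval_eq_lin_ext:
  "(\<Sum>(u, v)\<in>Poly_Mapping.keys t. \<iota> (Poly_Mapping.lookup t (u, v)) * (\<rho> u a * \<rho> v b)) =
    lin_ext \<iota> (\<lambda>p. \<rho> (fst p) a * \<rho> (snd p) b) t"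
  by (simp add: lin_ext_def case_prod_beta)

lemma lin_ext_free_comult:
  "lin_ext \<iota> \<phi> (free_comult g f) = lin_ext \<iota> (\<lambda>u. lin_ext \<iota> \<phi> (prod_list (map (gen_comult g) u))) f"
  unfolding free_comult_def by (simp add: lin_ext_sum lin_ext_scale) (simp add: lin_ext_def)

text \<open>
  A skew derivation is inner: the two ways to expand \<open>x(ab) = x(ba)\<close> give
  \<open>x(b) (a - \<sigma>(a)) = x(a) (b - \<sigma>(b))\<close>, so that \<open>x(b)\<close> and \<open>b - \<sigma>(b)\<close> have a constant ratio.
\<close>

lemma skew_derivation_inner:
  fixes x \<sigma> :: "'l \<Rightarrow> 'l"
  assumes "\<And>a b. x (a * b) = \<sigma> a * x b + x a * b" and "\<sigma> c \<noteq> c"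
  shows "x b = (x c / (c - \<sigma> c)) * (b - \<sigma> b)"
proof -
  have "\<sigma> c * x b + x c * b = \<sigma> b * x c + x b * c"
    using assms(1)[of c b] assms(1)[of b c] by (simp add: mult.commute)
  then have "x b * (c - \<sigma> c) = x c * (b - \<sigma> b)"
    by (simp add: algebra_simps)
  moreover have "c - \<sigma> c \<noteq> 0"
    using assms(2) by simp
  ultimately show ?thesis
    by (simp add: field_simps)
qed

end

context hopf_data
begin

lemma lin_ext_comult_rep:
  "lin_ext \<iota> \<phi> (comult_rep f) =
    lin_ext \<iota> (\<lambda>p. \<phi> (cl (monomial (fst p)), cl (monomial (snd p)))) (free_comult g f)"
  unfolding comult_rep_def by (simp add: lin_ext_sum case_prod_beta) (simp add: lin_ext_def case_prod_beta)

lemma g_neq_one: "i \<in> {1..\<theta>} \<Longrightarrow> g i \<noteq> \<one>\<^bsub>G\<^esub>"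
  using n_ge_2[of i] ord_g[of i] by auto

lemma monomial_closed: "u \<in> lists gens \<Longrightarrow> monomial u \<in> carrier free_alg"
  by (rule free_algebra_single)

lemma word_closed:
  "a \<in> carrier G \<Longrightarrow> [Grp a] \<in> lists gens" "i \<in> {1..\<theta>} \<Longrightarrow> [Skew i] \<in> lists gens" "[] \<in> lists gens"
  by auto

lemmas gen_closed = word_closed[THEN monomial_closed]

lemma monomial_mult: "monomial u * monomial v = (monomial (u @ v) :: _ \<Rightarrow>\<^sub>0 'k)"
  by (simp add: mult_single plus_list_def)

lemma monomial_Nil: "monomial [] = (1 :: 'x list \<Rightarrow>\<^sub>0 'k)"
  by (metis single_one zero_list_def)

lemma free_comult_Skew: "free_comult g (monomial [Skew i]) =
    Poly_Mapping.single ([Grp (g i)], [Skew i]) 1 + Poly_Mapping.single ([Skew i], []) (1 :: 'k)"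
  by (simp add: free_comult_def plus_poly_mapping.rep_eq mult_map_scale_conv_mult)

lemma comult_rep_Skew_mem:
  assumes i: "i \<in> {1..\<theta>}"
  shows "comult_rep (monomial [Skew i]) \<in> comult hopf (hopf_x G \<theta> n \<chi> i)"
proof -
  have gi: "g i \<in> carrier G"
    by (rule g_closed[OF i])
  have "Poly_Mapping.keys (free_comult g (monomial [Skew i] :: _ \<Rightarrow>\<^sub>0 'k))
      \<subseteq> {([Grp (g i)], [Skew i]), ([Skew i], [])}"
    unfolding free_comult_Skew by (rule order_trans[OF Poly_Mapping.keys_add]) auto
  then have "Poly_Mapping.keys (comult_rep (monomial [Skew i]))
      \<subseteq> {(cl (monomial [Grp (g i)]), cl (monomial [Skew i])), (cl (monomial [Skew i]), cl (monomial []))}"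
    unfolding comult_rep_def by (intro order_trans[OF Poly_Mapping.keys_sum]) (fastforce split: if_splits)
  also have "\<dots> \<subseteq> carrier hopf_mod \<times> carrier hopf_mod"
    using gen_closed gi i by (auto simp: carrier_hopf_mod)
  finally have "comult_rep (monomial [Skew i]) \<in> tensor_class hopf_mod (comult_rep (monomial [Skew i]))"
    unfolding tensor_class_def tensor_null_def using module.span_zero module_pm_scale by auto
  then show ?thesis
    unfolding comult_hopf hopf_x_def using cl_self by blast
qed

lemma extends_action_one:
  assumes "extends_action G \<theta> n g \<chi> \<iota> act \<rho>"
  shows "\<rho> (cl (monomial [])) l = l"
  using assms unfolding extends_action_def module_algebra_def
  by (simp add: monomial_Nil hopf_eq_hopf_mod hopf_mod_ops)

text \<open>This is the module algebra axiom at \<open>\<Delta>(x\<^sub>i) = g\<^sub>i \<otimes> x\<^sub>i + x\<^sub>i \<otimes> 1\<close>.\<close>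

lemma extends_action_skew_derivation:
  assumes ext: "extends_action G \<theta> n g \<chi> \<iota> act \<rho>" and i: "i \<in> {1..\<theta>}"
  shows "\<rho> (hopf_x G \<theta> n \<chi> i) (a * b) =
    act (g i) a * \<rho> (hopf_x G \<theta> n \<chi> i) b + \<rho> (hopf_x G \<theta> n \<chi> i) a * b"
proof -
  have "hopf_x G \<theta> n \<chi> i \<in> carrier hopf"
    using gen_closed(2)[OF i] by (auto simp: hopf_x_def hopf_eq_hopf_mod carrier_hopf_mod)
  then have "\<rho> (hopf_x G \<theta> n \<chi> i) (a * b) =
      lin_ext \<iota> (\<lambda>p. \<rho> (fst p) a * \<rho> (snd p) b) (comult_rep (monomial [Skew i]))"
    using ext comult_rep_Skew_mem[OF i]
    unfolding extends_action_def module_algebra_def tensor_eval_eq_lin_ext by blast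
  also have "\<dots> = \<rho> (hopf_grp G \<theta> n \<chi> (g i)) a * \<rho> (hopf_x G \<theta> n \<chi> i) b
      + \<rho> (hopf_x G \<theta> n \<chi> i) a * \<rho> (cl (monomial [])) b"
    by (simp add: lin_ext_comult_rep free_comult_Skew lin_ext_add hopf_grp_def hopf_x_def)
  also have "\<dots> = act (g i) a * \<rho> (hopf_x G \<theta> n \<chi> i) b + \<rho> (hopf_x G \<theta> n \<chi> i) a * b"
    using ext g_closed[OF i] by (simp add: extends_action_one[OF ext]) (simp add: extends_action_def)
  finally show ?thesis .
qed

lemma extends_action_mult:
  assumes ext: "extends_action G \<theta> n g \<chi> \<iota> act \<rho>"
    and "f \<in> carrier free_alg" "h \<in> carrier free_alg"
  shows "\<rho> (cl (f * h)) l = \<rho> (cl f) (\<rho> (cl h) l)"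
proof -
  have "\<rho> (cl f \<otimes>\<^bsub>hopf\<^esub> cl h) l = \<rho> (cl f) (\<rho> (cl h) l)"
    using ext assms(2,3) unfolding extends_action_def module_algebra_def hopf_eq_hopf_mod carrier_hopf_mod
    by blast
  then show ?thesis
    using assms by (simp add: hopf_eq_hopf_mod hopf_mod_ops)
qed

lemma extends_action_scale:
  assumes ext: "extends_action G \<theta> n g \<chi> \<iota> act \<rho>" and "f \<in> carrier free_alg"
  shows "\<rho> (cl (pm_scale c f)) l = \<iota> c * \<rho> (cl f) l"
proof -
  have "\<rho> (c \<odot>\<^bsub>hopf\<^esub> cl f) l = \<iota> c * \<rho> (cl f) l"
    using ext assms(2) unfolding extends_action_def module_algebra_def hopf_eq_hopf_mod carrier_hopf_mod
    by blast
  then show ?thesis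
    using assms by (simp add: hopf_eq_hopf_mod hopf_mod_ops)
qed

lemma extends_action_add:
  assumes ext: "extends_action G \<theta> n g \<chi> \<iota> act \<rho>"
    and "f \<in> carrier free_alg" "h \<in> carrier free_alg"
  shows "\<rho> (cl (f + h)) l = \<rho> (cl f) l + \<rho> (cl h) l"
proof -
  have "\<rho> (cl f \<oplus>\<^bsub>hopf\<^esub> cl h) l = \<rho> (cl f) l + \<rho> (cl h) l"
    using ext assms(2,3) unfolding extends_action_def module_algebra_def hopf_eq_hopf_mod carrier_hopf_mod
    by blast
  then show ?thesis
    using assms by (simp add: hopf_eq_hopf_mod hopf_mod_ops)
qed

lemma cl_grp_skew:
  assumes "a \<in> carrier G" "i \<in> {1..\<theta>}"
  shows "cl (monomial [Grp a] * monomial [Skew i])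
    = cl (pm_scale (\<chi> i a) (monomial [Skew i] * monomial [Grp a]))"
proof (rule cl_eqI)
  show "monomial [Grp a] * monomial [Skew i] \<in> carrier free_alg"
    using assms by (intro free_algebra_closed gen_closed)
  show "pm_scale (\<chi> i a) (monomial [Skew i] * monomial [Grp a]) \<in> carrier free_alg"
    using assms unfolding pm_scale_conv_mult
    by (intro free_algebra_closed gen_closed free_algebra_single) auto
  have "monomial [Grp a] * monomial [Skew i] - pm_scale (\<chi> i a) (monomial [Skew i] * monomial [Grp a])
      \<in> rels"
    using assms unfolding hopf_relations_def monomial_mult by auto
  then show "monomial [Grp a] * monomial [Skew i]
      - pm_scale (\<chi> i a) (monomial [Skew i] * monomial [Grp a]) \<in> rel_ideal"
    using rels_subset by blast
qed

lemma extends_action_commutation: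
  assumes ext: "extends_action G \<theta> n g \<chi> \<iota> act \<rho>" and a: "a \<in> carrier G" and i: "i \<in> {1..\<theta>}"
  shows "act a (\<rho> (hopf_x G \<theta> n \<chi> i) l) = \<iota> (\<chi> i a) * \<rho> (hopf_x G \<theta> n \<chi> i) (act a l)"
proof -
  have grp: "act a m = \<rho> (cl (monomial [Grp a])) m" for m
    using ext a by (simp add: extends_action_def hopf_grp_def)
  have "\<rho> (cl (monomial [Grp a] * monomial [Skew i])) l
      = \<rho> (cl (pm_scale (\<chi> i a) (monomial [Skew i] * monomial [Grp a]))) l"
    by (simp only: cl_grp_skew[OF a i])
  then show ?thesis
    unfolding grp hopf_x_def using gen_closed(1)[OF a] gen_closed(2)[OF i]
    by (simp only: extends_action_mult[OF ext] extends_action_scale[OF ext] free_algebra_closed)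
qed

text \<open>
  The ratio \<open>w\<^sub>i\<close> of \<open>skew_derivation_inner\<close> has weight \<open>\<chi>\<^sub>i\<close>: apply \<open>a\<close> to \<open>x\<^sub>i \<cdot> l = w\<^sub>i (l - g\<^sub>i l)\<close>
  and compare with the same formula at \<open>a l\<close>, using that \<open>G\<close> is abelian.
\<close>

lemma extension_given_by_formula:
  assumes ext: "extends_action G \<theta> n g \<chi> \<iota> act \<rho>"
  shows "\<exists>w. semi_invariants G \<theta> \<chi> \<iota> act w \<and> given_by_formula G \<theta> n g \<chi> act \<rho> w"
proof -
  have "\<forall>i\<in>{1..\<theta>}. \<exists>w. (\<forall>a\<in>carrier G. act a w = \<iota> (\<chi> i a) * w) \<and>
      (\<forall>l. \<rho> (hopf_x G \<theta> n \<chi> i) l = w * (l - act (g i) l))"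
  proof
    fix i assume i: "i \<in> {1..\<theta>}"
    obtain c where c: "act (g i) c \<noteq> c"
      using act_moves[OF g_closed[OF i] g_neq_one[OF i]] .
    define w where "w = \<rho> (hopf_x G \<theta> n \<chi> i) c / (c - act (g i) c)"
    have form: "\<rho> (hopf_x G \<theta> n \<chi> i) l = w * (l - act (g i) l)" for l
      unfolding w_def
      by (rule skew_derivation_inner[OF extends_action_skew_derivation[OF ext i] c])
    have "act a w = \<iota> (\<chi> i a) * w" if a: "a \<in> carrier G" for a
    proof -
      note gi = g_closed[OF i]
      have "act a (w * (c - act (g i) c)) = \<iota> (\<chi> i a) * (w * (act a c - act (g i) (act a c)))"
        using extends_action_commutation[OF ext a i, of c] by (simp only: form)
      then have "act a w * act a (c - act (g i) c) = \<iota> (\<chi> i a) * w * act a (c - act (g i) c)"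
        using a gi by (simp add: act_mult act_diff act_commute[of "g i" a])
      moreover have "act a (c - act (g i) c) \<noteq> 0"
        using c automorphism[OF a] a unfolding algebra_automorphism_def
        by (metis act_0 bij_pointE eq_iff_diff_eq_0)
      ultimately show ?thesis
        by simp
    qed
    with form show "\<exists>w. (\<forall>a\<in>carrier G. act a w = \<iota> (\<chi> i a) * w) \<and>
        (\<forall>l. \<rho> (hopf_x G \<theta> n \<chi> i) l = w * (l - act (g i) l))"
      by blast
  qed
  then obtain w where "\<forall>i\<in>{1..\<theta>}. (\<forall>a\<in>carrier G. act a (w i) = \<iota> (\<chi> i a) * w i) \<and>
      (\<forall>l. \<rho> (hopf_x G \<theta> n \<chi> i) l = w i * (l - act (g i) l))"
    by metis
  then show ?thesis
    unfolding semi_invariants_def given_by_formula_def by blast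
qed

end

section \<open>Nilpotency of the operators\<close>

context field_action
begin

lemma linear_op_skew:
  assumes "b \<in> carrier G"
  shows "linear_op (\<lambda>l. w * (l - act b l))"
  using linear_op_act[OF assms] by (simp add: linear_op_def algebra_simps)

lemma linear_op_funpow: "linear_op F \<Longrightarrow> linear_op (F ^^ m)"
  by (induction m) (simp_all add: linear_op_def)

text \<open>
  As \<open>b(w) = q w\<close>, the element \<open>w\<^sup>j v\<close> is an eigenvector for \<open>q\<^sup>j c\<close>; so the next application of
  \<open>w (1 - b)\<close> contributes the factor \<open>1 - q\<^sup>j c\<close>.
\<close>

lemma skew_op_power_eigenvector:
  assumes b: "b \<in> carrier G" and w: "act b w = \<iota> q * w" and v: "act b v = \<iota> c * v"
  shows "((\<lambda>l. w * (l - act b l)) ^^ k) v = w ^ k * \<iota> (\<Prod>j<k. 1 - q ^ j * c) * v"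
proof (induction k)
  case (Suc k)
  let ?P = "\<Prod>j<k. 1 - q ^ j * c"
  have "act b (w ^ k * \<iota> ?P * v) = \<iota> (q ^ k * c) * (w ^ k * \<iota> ?P * v)"
    using b by (simp add: act_mult act_power w v power_mult_distrib emb_power emb_mult)
  then have "w ^ k * \<iota> ?P * v - act b (w ^ k * \<iota> ?P * v) = (1 - \<iota> (q ^ k * c)) * (w ^ k * \<iota> ?P * v)"
    by (simp add: algebra_simps)
  then show ?case
    using Suc by (simp add: emb_mult emb_diff mult_ac)
qed simp

text \<open>
  Since the scalars contain a primitive \<open>m\<close>-th root of unity \<open>q\<close>, \<open>m l\<close> is a sum of eigenvectors
  \<open>e\<^sub>j\<close> of \<open>b\<close>, the eigenvalue of \<open>e\<^sub>j\<close> being \<open>q\<^sup>-\<^sup>j\<close>; and \<open>m\<close> is invertible. On \<open>e\<^sub>j\<close> the \<open>m\<close>-th power of \<open>w(1 - b)\<close> is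
  multiplication by \<open>w\<^sup>m \<Prod>\<^sub>i (1 - q\<^sup>i q\<^sup>-\<^sup>j)\<close>, in which the factor for \<open>i = j\<close> vanishes.
\<close>

lemma skew_op_nilpotent:
  assumes b: "b \<in> carrier G" "b [^]\<^bsub>G\<^esub> m = \<one>\<^bsub>G\<^esub>" and w: "act b w = \<iota> q * w"
    and q: "q ^ m = 1" "\<And>k. 0 < k \<Longrightarrow> k < m \<Longrightarrow> q ^ k \<noteq> 1" and m: "of_nat m \<noteq> (0 :: 'k)"
  shows "((\<lambda>l. w * (l - act b l)) ^^ m) l = 0"
proof -
  have "m > 0"
    using m by (cases m) auto
  have q0: "q \<noteq> 0"
    using q(1) \<open>m > 0\<close> by (auto simp: power_0_left)
  define F where "F = (\<lambda>l. w * (l - act b l))"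
  have linF: "linear_op (F ^^ m)"
    unfolding F_def by (intro linear_op_funpow linear_op_skew b)
  define e where "e j = (\<Sum>k<m. \<iota> (q ^ (j * k)) * (act b ^^ k) l)" for j
  have eigen: "act b (e j) = \<iota> (inverse q ^ j) * e j" for j
  proof -
    \<comment> \<open>Applying \<open>q\<^sup>j b\<close> shifts the summation index, and the sum is periodic because \<open>q\<^sup>m = 1\<close> and \<open>b\<^sup>m = 1\<close>.\<close>
    let ?f = "\<lambda>k. \<iota> (q ^ (j * k)) * (act b ^^ k) l"
    have "?f m = ?f 0"
      using q(1) act_nat_pow[OF b(1), of m l] b(2)
      by (simp add: power_mult mult.commute[of j])
    have "\<iota> (q ^ j) * act b (e j) = (\<Sum>k<m. ?f (Suc k))"
      unfolding e_def using b(1)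
      by (simp add: act_sum act_mult sum_distrib_left power_add emb_mult mult.assoc)
    also have "\<dots> = e j"
      using sum.lessThan_Suc_shift[of ?f m] \<open>?f m = ?f 0\<close> by (simp add: e_def)
    finally have "\<iota> (inverse q ^ j) * (\<iota> (q ^ j) * act b (e j)) = \<iota> (inverse q ^ j) * e j"
      by simp
    moreover have "inverse q ^ j * q ^ j = 1"
      using q0 by (simp flip: power_mult_distrib)
    ultimately show ?thesis
      by (metis emb_1 emb_mult mult.assoc mult_1)
  qed
  have "(F ^^ m) (e j) = 0" if "j < m" for j
  proof -
    have "q ^ j * inverse q ^ j = 1"
      using q0 by (simp flip: power_mult_distrib)
    then have "(\<Prod>i<m. 1 - q ^ i * inverse q ^ j) = 0"
      using that by (intro prod_zero) auto
    then show ?thesis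
      unfolding F_def using skew_op_power_eigenvector[OF b(1) w eigen] by simp
  qed
  then have "(F ^^ m) (\<Sum>j<m. e j) = 0"
    by (simp add: linear_op_sum[OF linF])
  moreover have "(\<Sum>j<m. e j) = \<iota> (of_nat m) * l"
  proof -
    have geom: "(\<Sum>j<m. q ^ (j * k)) = (if k = 0 then of_nat m else 0)" if "k < m" for k
    proof (cases "k = 0")
      case False
      have "(\<Sum>j<m. q ^ (j * k)) = (\<Sum>j<m. (q ^ k) ^ j)"
        by (simp add: power_mult mult.commute flip: power_mult)
      also have "\<dots> = ((q ^ k) ^ m - 1) / (q ^ k - 1)"
        using q(2)[of k] False that by (intro geometric_sum) auto
      also have "(q ^ k) ^ m = 1"
        by (metis q(1) mult.commute power_mult power_one)
      finally show ?thesis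
        using False by simp
    qed simp
    have "(\<Sum>j<m. e j) = (\<Sum>k<m. \<iota> (\<Sum>j<m. q ^ (j * k)) * (act b ^^ k) l)"
      unfolding e_def by (subst sum.swap) (simp add: emb_sum sum_distrib_right)
    also have "\<dots> = (\<Sum>k<m. if k = 0 then \<iota> (of_nat m) * (act b ^^ k) l else 0)"
      by (intro sum.cong) (simp_all add: geom)
    also have "\<dots> = \<iota> (of_nat m) * l"
      using \<open>m > 0\<close> by simp
    finally show ?thesis .
  qed
  ultimately have "\<iota> (of_nat m) * (F ^^ m) l = 0"
    using linF unfolding linear_op_def by metis
  then show ?thesis
    using m by (simp add: F_def)
qed

end

lemma group_unit_group: "group (unit_group :: 'k::field monoid)"
  by (rule groupI) (auto simp: unit_group_def intro: bexI[of _ "inverse _"] left_inverse)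

lemma unit_group_nat_pow: "x [^]\<^bsub>unit_group\<^esub> (m::nat) = x ^ m"
  by (induction m) (simp_all add: nat_pow_def unit_group_def)

section \<open>Every choice of semi-invariants defines an action\<close>

locale skew_action = hopf_data \<iota> G act \<theta> n g \<chi>
  for \<iota> :: "'k::{alg_closed_field, field_char_0} \<Rightarrow> 'l::field"
    and G :: "('g, 'm) monoid_scheme" and act \<theta> n g \<chi> +
  fixes w :: "nat \<Rightarrow> 'l"
  assumes semi: "semi_invariants G \<theta> \<chi> \<iota> act w"
begin

fun gen_op :: "'g generator \<Rightarrow> 'l \<Rightarrow> 'l"
  where
    "gen_op (Grp a) = act a"
  | "gen_op (Skew i) = (\<lambda>l. w i * (l - act (g i) l))"

definition free_op :: "('g generator list \<Rightarrow>\<^sub>0 'k) \<Rightarrow> 'l \<Rightarrow> 'l"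
  where "free_op f l = lin_ext \<iota> (\<lambda>u. foldr gen_op u l) f"

text \<open>The choice of the representative is immaterial, by \<open>free_op_cong\<close> below.\<close>

definition hopf_op :: "('g generator list \<Rightarrow>\<^sub>0 'k) set \<Rightarrow> 'l \<Rightarrow> 'l"
  where "hopf_op C = free_op (SOME f. f \<in> C)"

lemma linear_op_word: "u \<in> lists gens \<Longrightarrow> linear_op (foldr gen_op u)"
  by (rule linear_op_foldr) (auto simp: linear_op_act linear_op_skew g_closed)

lemma linear_op_free_op: "f \<in> carrier free_alg \<Longrightarrow> linear_op (free_op f)"
  unfolding free_op_def[abs_def] carrier_free_algebra
  by (rule linear_op_lin_ext_param, rule linear_op_word) blast

lemma free_op_mult:
  assumes "f \<in> carrier free_alg"
  shows "free_op (f * h) l = free_op f (free_op h l)"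
proof -
  have "free_op (f * h) l = lin_ext \<iota> (\<lambda>u. lin_ext \<iota> (\<lambda>v. foldr gen_op u (foldr gen_op v l)) h) f"
    by (simp add: free_op_def lin_ext_mult plus_list_def)
  also have "\<dots> = free_op f (free_op h l)"
    unfolding free_op_def
    by (rule lin_ext_cong, rule linear_op_lin_ext[symmetric], rule linear_op_word)
      (use assms in \<open>auto simp: carrier_free_algebra\<close>)
  finally show ?thesis .
qed

lemma free_op_single [simp]: "free_op (Poly_Mapping.single u c) l = \<iota> c * foldr gen_op u l"
  by (simp add: free_op_def)

lemma free_op_one [simp]: "free_op 1 l = l"
  by (simp flip: monomial_Nil)

lemma free_op_power: "f \<in> carrier free_alg \<Longrightarrow> free_op (f ^ m) l = (free_op f ^^ m) l"
  by (induction m) (simp_all add: free_op_mult)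

lemma free_op_add: "free_op (f + h) l = free_op f l + free_op h l"
  and free_op_diff: "free_op (f - h) l = free_op f l - free_op h l"
  and free_op_minus: "free_op (- f) l = - free_op f l"
  and free_op_scale: "free_op (pm_scale c f) l = \<iota> c * free_op f l"
  by (simp_all add: free_op_def lin_ext_add lin_ext_diff lin_ext_minus lin_ext_scale)

lemma skew_op_nilpotent_gen:
  assumes i: "i \<in> {1..\<theta>}"
  shows "(gen_op (Skew i) ^^ n i) l = 0"
proof -
  interpret units: group "unit_group :: 'k monoid"
    by (rule group_unit_group)
  have \<chi>g: "\<chi> i (g i) \<in> carrier unit_group"
    using \<chi>_hom[OF i] g_closed[OF i] by (auto simp: hom_def)
  have pow: "\<chi> i (g i) ^ k = 1 \<longleftrightarrow> n i dvd k" for k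
    using units.pow_eq_id[OF \<chi>g, of k] ord_\<chi>g[OF i]
    by (simp add: unit_group_nat_pow) (simp add: unit_group_def)
  show ?thesis
    unfolding gen_op.simps
  proof (rule skew_op_nilpotent)
    show "g i \<in> carrier G" "g i [^]\<^bsub>G\<^esub> n i = \<one>\<^bsub>G\<^esub>"
      using g_closed[OF i] pow_ord_eq_1[of "g i"] by (simp_all add: ord_g[OF i])
    show "act (g i) (w i) = \<iota> (\<chi> i (g i)) * w i"
      using semi i g_closed[OF i] by (simp add: semi_invariants_def)
    show "\<chi> i (g i) ^ n i = 1"
      by (simp add: pow)
    show "\<chi> i (g i) ^ k \<noteq> 1" if "0 < k" "k < n i" for k
      using that by (auto simp: pow dest: dvd_imp_le)
    show "of_nat (n i) \<noteq> (0 :: 'k)"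
      using n_ge_2[OF i] by simp
  qed
qed

lemma free_op_rels:
  assumes "f \<in> rels"
  shows "free_op f l = 0"
proof -
  from assms consider
      a b where "a \<in> carrier G" "b \<in> carrier G"
        "f = monomial [Grp a, Grp b] - monomial [Grp (a \<otimes>\<^bsub>G\<^esub> b)]"
    | "f = monomial [Grp \<one>\<^bsub>G\<^esub>] - 1"
    | i where "i \<in> {1..\<theta>}" "f = monomial [Skew i] ^ n i"
    | a i where "a \<in> carrier G" "i \<in> {1..\<theta>}"
        "f = monomial [Grp a, Skew i] - pm_scale (\<chi> i a) (monomial [Skew i, Grp a])"
    unfolding hopf_relations_def by blast
  then show ?thesis
  proof cases
    case 1
    then show ?thesis
      by (simp add: free_op_diff act_compose)
  next
    case 2
    then show ?thesis
      by (simp add: free_op_diff)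
  next
    case 3
    have "free_op (monomial [Skew i]) = gen_op (Skew i)"
      by (rule ext) simp
    then show ?thesis
      using 3 by (simp only: free_op_power gen_closed skew_op_nilpotent_gen)
  next
    case 4
    then show ?thesis
      using semi g_closed[OF 4(2)]
      by (simp add: free_op_diff free_op_scale act_mult act_diff semi_invariants_def
          act_commute[of "g i" a] emb_mult)
  qed
qed

text \<open>The elements of the free algebra that act as zero form an ideal, and this ideal contains the relations.\<close>

lemma free_op_rel_ideal:
  assumes "f \<in> rel_ideal"
  shows "free_op f l = 0"
proof -
  let ?K = "{f \<in> carrier free_alg. \<forall>l. free_op f l = 0}"
  have "ideal ?K free_alg"
  proof (rule idealI)
    show "ring free_alg"
      by (rule free_alg.ring_axioms)
    show "subgroup ?K (add_monoid free_alg)"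
    proof (rule free_alg.add.subgroupI)
      fix f assume f: "f \<in> ?K"
      then have "\<ominus>\<^bsub>free_alg\<^esub> f = - f"
        by (intro free_alg.minus_equality) (auto simp: free_algebra_uminus)
      then show "\<ominus>\<^bsub>free_alg\<^esub> f \<in> ?K"
        using f by (simp add: free_algebra_uminus free_op_minus)
    next
      have "0 \<in> ?K"
        by (simp add: free_op_def free_algebra_consts)
      then show "?K \<noteq> {}"
        by blast
    qed (auto simp: free_algebra_closed free_op_add)
  next
    fix f h assume "f \<in> ?K" "h \<in> carrier free_alg"
    then show "h \<otimes>\<^bsub>free_alg\<^esub> f \<in> ?K" "f \<otimes>\<^bsub>free_alg\<^esub> h \<in> ?K"
      by (auto simp: free_algebra_closed free_op_mult linear_op_0 linear_op_free_op)
  qed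
  moreover have "rels \<subseteq> ?K"
    using rels_closed free_op_rels by auto
  ultimately show ?thesis
    using rel_ideal_minimal assms by blast
qed

lemma free_op_cong: "f' \<in> cl f \<Longrightarrow> free_op f' l = free_op f l"
  using free_op_rel_ideal[of "f' - f" l] by (simp add: mem_cl_iff free_op_diff)

lemma hopf_op_cl: "hopf_op (cl f) l = free_op f l"
  unfolding hopf_op_def using cl_self by (intro free_op_cong) (rule someI)

text \<open>
  Compatibility with products has to be checked on generators only, since both sides are
  multiplicative in the word: there it reads \<open>a(lm) = a(l) a(m)\<close> and
  \<open>lm - g(lm) = g(l) (m - g(m)) + (l - g(l)) m\<close>.
\<close>

lemma word_op_comult:
  "u \<in> lists gens \<Longrightarrow> foldr gen_op u (l * m) =
    lin_ext \<iota> (\<lambda>p. foldr gen_op (fst p) l * foldr gen_op (snd p) m) (prod_list (map (gen_comult g) u))"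
proof (induction u)
  case Nil
  have one: "(1 :: 'g generator list \<times> 'g generator list \<Rightarrow>\<^sub>0 'k) = Poly_Mapping.single ([], []) 1"
    by (metis single_one zero_list_def zero_prod_def)
  show ?case
    by (simp only: list.map prod_list.Nil one lin_ext_single) simp
next
  case (Cons x u)
  define P where "P = (prod_list (map (gen_comult g) u) :: _ \<Rightarrow>\<^sub>0 'k)"
  let ?\<phi> = "\<lambda>p. foldr gen_op (fst p) l * foldr gen_op (snd p) m"
  have IH: "foldr gen_op u (l * m) = lin_ext \<iota> ?\<phi> P"
    using Cons by (simp add: P_def)
  have split: "lin_ext \<iota> ?\<phi> (prod_list (map (gen_comult g) (x # u)))
      = lin_ext \<iota> (\<lambda>p. lin_ext \<iota> (\<lambda>q. ?\<phi> (p + q)) P) (gen_comult g x)"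
    by (simp add: lin_ext_mult flip: P_def)
  show ?case
  proof (cases x)
    case (Grp a)
    then have a: "a \<in> carrier G"
      using Cons.prems by auto
    show ?thesis
      unfolding split using a
      by (simp add: Grp plus_list_def IH linear_op_lin_ext[OF linear_op_act] act_mult)
  next
    case (Skew i)
    then have "i \<in> {1..\<theta>}"
      using Cons.prems by auto
    then have gi: "g i \<in> carrier G"
      by (rule g_closed)
    let ?x = "\<lambda>l. w i * (l - act (g i) l)"
    have "lin_ext \<iota> ?\<phi> (prod_list (map (gen_comult g) (x # u))) =
        lin_ext \<iota> (\<lambda>q. act (g i) (foldr gen_op (fst q) l) * ?x (foldr gen_op (snd q) m)) P
        + lin_ext \<iota> (\<lambda>q. ?x (foldr gen_op (fst q) l) * foldr gen_op (snd q) m) P"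
      unfolding split by (simp add: Skew lin_ext_add plus_list_def)
    also have "\<dots> = lin_ext \<iota> (\<lambda>q. ?x (?\<phi> q)) P"
      unfolding lin_ext_def using gi
      by (simp add: act_mult algebra_simps flip: sum.distrib)
    also have "\<dots> = ?x (lin_ext \<iota> ?\<phi> P)"
      by (rule linear_op_lin_ext[OF linear_op_skew[OF gi], symmetric])
    finally show ?thesis
      by (simp add: Skew IH)
  qed
qed

text \<open>
  The functional \<open>u \<otimes> v \<mapsto> (u \<cdot> l) (v \<cdot> m)\<close> kills the bilinearity relations, so all representatives
  of \<open>\<Delta>(h)\<close> take the same value.
\<close>

lemma lin_ext_tensor_null:
  assumes "t \<in> tensor_null hopf_mod"
  shows "lin_ext \<iota> (\<lambda>p. hopf_op (fst p) l * hopf_op (snd p) m) t = 0"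
proof -
  let ?\<phi> = "\<lambda>p. hopf_op (fst p) l * hopf_op (snd p) m"
  have "Modules.module.subspace pm_scale {t. lin_ext \<iota> ?\<phi> t = 0}"
    unfolding Modules.module.subspace_def[OF module_pm_scale] by (simp add: lin_ext_add lin_ext_scale)
  moreover have "tensor_rels hopf_mod \<subseteq> {t. lin_ext \<iota> ?\<phi> t = 0}"
    unfolding tensor_rels_def carrier_hopf_mod
    by (auto simp: lin_ext_add lin_ext_diff hopf_mod_ops hopf_op_cl free_op_add free_op_scale
        distrib_left distrib_right mult.assoc mult.left_commute)
  ultimately have "tensor_null hopf_mod \<subseteq> {t. lin_ext \<iota> ?\<phi> t = 0}"
    unfolding tensor_null_def by (rule Modules.module.span_minimal[OF module_pm_scale, rotated])
  then show ?thesis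
    using assms by auto
qed

lemma hopf_op_comult:
  assumes f: "f \<in> carrier free_alg" and t: "t \<in> comult hopf (cl f)"
  shows "hopf_op (cl f) (l * m) = lin_ext \<iota> (\<lambda>p. hopf_op (fst p) l * hopf_op (snd p) m) t"
proof -
  obtain f' where f': "f' \<in> cl f" and t': "t - comult_rep f' \<in> tensor_null hopf_mod"
    using t by (auto simp: comult_hopf tensor_class_def)
  have closed: "f' \<in> carrier free_alg"
    using f f' cl_subset by blast
  have "lin_ext \<iota> (\<lambda>p. hopf_op (fst p) l * hopf_op (snd p) m) t
      = lin_ext \<iota> (\<lambda>p. hopf_op (fst p) l * hopf_op (snd p) m) (comult_rep f')"
    using lin_ext_tensor_null[OF t', of l m] by (simp add: lin_ext_diff)
  also have "\<dots> = lin_ext \<iota> (\<lambda>p. foldr gen_op (fst p) l * foldr gen_op (snd p) m) (free_comult g f')"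
    by (simp add: lin_ext_comult_rep hopf_op_cl)
  also have "\<dots> = free_op f' (l * m)"
    unfolding lin_ext_free_comult free_op_def
    by (rule lin_ext_cong, rule word_op_comult[symmetric]) (use closed in \<open>auto simp: carrier_free_algebra\<close>)
  also have "\<dots> = hopf_op (cl f) (l * m)"
    using f' by (simp add: hopf_op_cl free_op_cong)
  finally show ?thesis ..
qed

lemma word_op_counit: "u \<in> lists gens \<Longrightarrow> foldr gen_op u 1 = \<iota> (prod_list (map gen_counit u))"
proof (induction u)
  case (Cons x u)
  show ?case
  proof (cases x)
    case (Grp a)
    with Cons show ?thesis
      by auto
  next
    case (Skew i)
    with Cons show ?thesis
      by (auto simp: g_closed)
  qed
qed simp

lemma free_op_counit:
  assumes "f \<in> carrier free_alg"
  shows "free_op f 1 = \<iota> (free_counit f)"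
proof -
  have "free_op f 1 = lin_ext \<iota> (\<lambda>u. \<iota> (prod_list (map gen_counit u))) f"
    unfolding free_op_def
    by (rule lin_ext_cong, rule word_op_counit) (use assms in \<open>auto simp: carrier_free_algebra\<close>)
  then show ?thesis
    by (simp add: lin_ext_def free_counit_def emb_sum emb_mult)
qed

text \<open>
  The counit of a class is read off any representative: the value at \<open>1\<close> of the action determines it,
  as \<open>\<iota>\<close> is injective.
\<close>

lemma hopf_op_counit:
  assumes "f \<in> carrier free_alg"
  shows "hopf_op (cl f) 1 = \<iota> (counit hopf (cl f))"
proof -
  have "free_counit f' = free_counit f" if "f' \<in> cl f" for f'
  proof -
    have "f' \<in> carrier free_alg"
      using that assms cl_subset by blast
    then have "\<iota> (free_counit f') = \<iota> (free_counit f)"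
      using assms free_op_cong[OF that, of 1] by (simp add: free_op_counit)
    then show ?thesis
      by simp
  qed
  then have "free_counit ` cl f = {free_counit f}"
    using cl_self by blast
  then show ?thesis
    by (simp add: counit_hopf hopf_op_cl free_op_counit[OF assms])
qed

lemma extends_action_hopf_op: "extends_action G \<theta> n g \<chi> \<iota> act hopf_op"
  unfolding extends_action_def
proof
  have lin: "\<And>f. f \<in> carrier free_alg \<Longrightarrow> linear_op (hopf_op (cl f))"
    using linear_op_free_op by (simp add: linear_op_def hopf_op_cl)
  show "module_algebra hopf \<iota> hopf_op"
    unfolding module_algebra_def tensor_eval_eq_lin_ext hopf_eq_hopf_mod carrier_hopf_mod
    using lin
    by (auto simp: hopf_mod_ops hopf_op_comult hopf_op_counit linear_op_def)
      (simp_all add: hopf_op_cl free_op_add free_op_scale free_op_mult)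
  show "\<forall>a\<in>carrier G. \<forall>l. hopf_op (hopf_grp G \<theta> n \<chi> a) l = act a l"
    by (simp add: hopf_grp_def hopf_op_cl)
qed

lemma given_by_formula_hopf_op: "given_by_formula G \<theta> n g \<chi> act hopf_op w"
  by (simp add: given_by_formula_def hopf_x_def hopf_op_cl)

lemma extension_unique_word:
  assumes ext: "extends_action G \<theta> n g \<chi> \<iota> act \<rho>" and form: "given_by_formula G \<theta> n g \<chi> act \<rho> w"
  shows "u \<in> lists gens \<Longrightarrow> \<rho> (cl (monomial u)) l = foldr gen_op u l"
proof (induction u arbitrary: l)
  case Nil
  show ?case
    by (simp add: extends_action_one[OF ext])
next
  case (Cons x u)
  then have x: "[x] \<in> lists gens" "x \<in> gens" and u: "u \<in> lists gens"
    by auto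
  have "monomial (x # u) = (monomial [x] * monomial u :: _ \<Rightarrow>\<^sub>0 'k)"
    by (simp add: monomial_mult)
  then have "\<rho> (cl (monomial (x # u))) l = \<rho> (cl (monomial [x])) (foldr gen_op u l)"
    using Cons.IH[OF u] by (simp only: extends_action_mult[OF ext] monomial_closed x u)
  also have "\<dots> = gen_op x (foldr gen_op u l)"
    using x(2) ext form
    by (auto simp: extends_action_def given_by_formula_def hopf_grp_def hopf_x_def)
  finally show ?case
    by simp
qed

lemma extension_unique:
  assumes ext: "extends_action G \<theta> n g \<chi> \<iota> act \<rho>" and form: "given_by_formula G \<theta> n g \<chi> act \<rho> w"
    and h: "h \<in> carrier hopf"
  shows "\<rho> h = hopf_op h"
proof -
  obtain f where f: "f \<in> carrier free_alg" and hf: "h = cl f"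
    using h by (auto simp: hopf_eq_hopf_mod carrier_hopf_mod)
  have single: "\<rho> (cl (Poly_Mapping.single u c)) l = \<iota> c * foldr gen_op u l"
    if "u \<in> lists gens" for u c l
  proof -
    have "Poly_Mapping.single u c = pm_scale c (monomial u)"
      by (intro poly_mapping_eqI) (simp add: lookup_single when_def)
    then show ?thesis
      using that by (simp only: extends_action_scale[OF ext monomial_closed] extension_unique_word[OF ext form])
  qed
  have "\<rho> (cl (\<Sum>u\<in>A. Poly_Mapping.single u (c u))) l = free_op (\<Sum>u\<in>A. Poly_Mapping.single u (c u)) l
      \<and> (\<Sum>u\<in>A. Poly_Mapping.single u (c u)) \<in> carrier free_alg"
    if "finite A" "A \<subseteq> lists gens" for A c l
    using that
  proof (induction A)
    case empty
    show ?case
      using single[of "[]" 0] by (simp add: free_op_def free_algebra_consts)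
  next
    case (insert u A)
    then show ?case
      by (simp add: extends_action_add[OF ext] free_algebra_single free_algebra_closed free_op_add single)
  qed
  from this[OF finite_keys, of f "Poly_Mapping.lookup f"] f
  have "\<rho> (cl f) l = free_op f l" for l
    by (simp add: carrier_free_algebra flip: poly_mapping_as_sum)
  then show ?thesis
    by (auto simp: hf hopf_op_cl)
qed

end

section \<open>Linear independence\<close>

text \<open>
  For finite families the criterion with coefficients indexed by the family also covers the
  injectivity demanded by \<^const>\<open>independent_family\<close>.
\<close>

lemma independent_family_iff:
  fixes scale :: "'k::field \<Rightarrow> 'v::ab_group_add \<Rightarrow> 'v"
  assumes "Modules.module scale" and I: "finite I"
  shows "independent_family scale I v \<longleftrightarrow>
    (\<forall>c. (\<Sum>i\<in>I. scale (c i) (v i)) = 0 \<longrightarrow> (\<forall>i\<in>I. c i = 0))"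
proof
  interpret Modules.module scale by fact
  assume ind: "independent_family scale I v"
  then have inj: "inj_on v I"
    by (simp add: independent_family_def)
  show "\<forall>c. (\<Sum>i\<in>I. scale (c i) (v i)) = 0 \<longrightarrow> (\<forall>i\<in>I. c i = 0)"
  proof (intro allI impI)
    fix c assume sum0: "(\<Sum>i\<in>I. scale (c i) (v i)) = 0"
    let ?u = "\<lambda>x. c (inv_into I v x)"
    have indep: "\<nexists>u. (\<exists>x\<in>v ` I. u x \<noteq> 0) \<and> (\<Sum>x\<in>v ` I. scale (u x) x) = 0"
      using ind[unfolded independent_family_def dependent_finite[OF finite_imageI[OF I]]]
      by (rule conjunct2)
    have "(\<Sum>x\<in>v ` I. scale (?u x) x) = 0"
      using sum0 by (simp add: sum.reindex[OF inj] inv_into_f_f[OF inj])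
    with indep[THEN not_ex[THEN iffD1], THEN spec, of ?u] have "\<forall>x\<in>v ` I. ?u x = 0"
      by simp
    then show "\<forall>i\<in>I. c i = 0"
      by (simp add: inv_into_f_f[OF inj])
  qed
next
  interpret Modules.module scale by fact
  assume R: "\<forall>c. (\<Sum>i\<in>I. scale (c i) (v i)) = 0 \<longrightarrow> (\<forall>i\<in>I. c i = 0)"
  have inj: "inj_on v I"
  proof (rule inj_onI, rule ccontr)
    fix i j assume ij: "i \<in> I" "j \<in> I" "v i = v j" "i \<noteq> j"
    \<comment> \<open>Repeated members satisfy the relation \<open>v i - v j = 0\<close>.\<close>
    let ?c = "\<lambda>k. if k = i then 1 else if k = j then - 1 else (0::'k)"
    have "(\<Sum>k\<in>I. scale (?c k) (v k)) = (\<Sum>k\<in>{i, j}. scale (?c k) (v k))"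
      by (rule sum.mono_neutral_right) (use ij I in auto)
    also have "\<dots> = 0"
      using ij by simp
    finally have "?c i = 0"
      using R[rule_format, of ?c i] ij(1) by blast
    then show False
      by simp
  qed
  have "\<not> dependent (v ` I)"
  proof
    assume "dependent (v ` I)"
    then obtain u where u: "\<exists>x\<in>v ` I. u x \<noteq> 0" "(\<Sum>x\<in>v ` I. scale (u x) x) = 0"
      using I dependent_finite[of "v ` I"] by blast
    then have "(\<Sum>i\<in>I. scale (u (v i)) (v i)) = 0"
      by (simp add: sum.reindex[OF inj])
    then show False
      using R[rule_format, of "\<lambda>i. u (v i)"] u(1) by auto
  qed
  with inj show "independent_family scale I v"
    by (simp add: independent_family_def)
qed

text \<open>
  Dedekind's argument: comparing a relation at \<open>a l\<close> with \<open>h(a)\<close> times the relation at \<open>l\<close>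
  removes the character \<open>h\<close>.
\<close>

lemma multiplicative_maps_independent:
  fixes c :: "('a::monoid_mult \<Rightarrow> 'l::field) \<Rightarrow> 'l"
  assumes "finite A" and "\<And>f. f \<in> A \<Longrightarrow> f 1 = 1 \<and> (\<forall>a b. f (a * b) = f a * f b)"
    and "\<And>l. (\<Sum>f\<in>A. c f * f l) = 0" and "f \<in> A"
  shows "c f = 0"
  using assms
proof (induction A arbitrary: c f)
  case (insert h A)
  have mult: "k (a * b) = k a * k b" if "k \<in> insert h A" for k a b
    using insert.prems(1)[OF that] by blast
  have rel: "c h * h l + (\<Sum>k\<in>A. c k * k l) = 0" for l
    using insert.prems(2)[of l] insert.hyps by simp
  have zero: "c k * (k a - h a) = 0" if "k \<in> A" for k a
  proof (rule insert.IH[of "\<lambda>k. c k * (k a - h a)"])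
    fix l
    have "(\<Sum>k\<in>A. c k * (k a - h a) * k l) = (\<Sum>k\<in>A. c k * k (a * l)) - h a * (\<Sum>k\<in>A. c k * k l)"
      by (simp add: mult sum_distrib_left algebra_simps flip: sum_subtractf)
    also have "\<dots> = (c h * h (a * l) + (\<Sum>k\<in>A. c k * k (a * l))) - h a * (c h * h l + (\<Sum>k\<in>A. c k * k l))"
      by (simp add: mult algebra_simps)
    also have "\<dots> = 0"
      by (simp only: rel) simp
    finally show "(\<Sum>k\<in>A. c k * (k a - h a) * k l) = 0" .
  qed (use insert.prems that in auto)
  have A: "c k = 0" if k: "k \<in> A" for k
  proof -
    obtain a where "k a \<noteq> h a"
      using k insert.hyps(2) by (metis ext)
    then show ?thesis
      using zero[OF k, of a] by simp
  qed
  then have "c h = 0"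
    using rel[of 1] insert.prems(1)[of h] by simp
  with A insert.prems(3) show ?case
    by auto
qed simp

locale alg_closed_field_extension = field_extension \<iota>
  for \<iota> :: "'k::alg_closed_field \<Rightarrow> 'l::field"
begin

text \<open>Over an algebraically closed field \<open>p\<close> splits, so \<open>y\<close> is a root of one of its linear factors.\<close>

lemma algebraic_imp_in_base:
  assumes "p \<noteq> 0" "poly (map_poly \<iota> p) y = 0"
  shows "y \<in> range \<iota>"
  using assms
proof (induction "degree p" arbitrary: p)
  case 0
  then obtain a where "p = [:a:]"
    by (metis degree_eq_zeroE)
  with 0 show ?case
    by (simp add: map_poly_pCons)
next
  case (Suc d)
  obtain r where "poly p r = 0"
    using alg_closed_imp_poly_has_root[of p] Suc.hyps(2) by auto
  then obtain q where p: "p = [:- r, 1:] * q"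
    by (auto simp: poly_eq_0_iff_dvd dvd_def)
  then have q: "q \<noteq> 0"
    using Suc.prems by auto
  have "degree p = degree [:- r, 1:] + degree q"
    unfolding p using q by (intro degree_mult_eq) auto
  then have deg: "d = degree q"
    using Suc.hyps(2) by simp
  have "map_poly \<iota> p = smult (- \<iota> r) (map_poly \<iota> q) + pCons 0 (map_poly \<iota> q)"
    by (rule poly_eqI) (simp add: p coeff_map_poly emb_diff emb_add emb_mult emb_minus coeff_pCons
        split: nat.splits)
  then have "(y - \<iota> r) * poly (map_poly \<iota> q) y = 0"
    using Suc.prems(2) by (simp only: poly_add poly_smult poly_pCons) (simp add: algebra_simps)
  then have "y = \<iota> r \<or> poly (map_poly \<iota> q) y = 0"
    by auto
  then show ?case
    using Suc.hyps(1)[OF deg q] by auto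
qed

text \<open>An element outside the base field is transcendental, so its powers satisfy no linear relation.\<close>

lemma powers_independent:
  fixes N :: nat
  assumes y: "y \<notin> range \<iota>" and "N > 0" and I: "finite I"
    and sum0: "(\<Sum>i\<in>I. \<iota> (c i) * y ^ (N * i)) = 0" and i: "i \<in> I"
  shows "c i = 0"
proof -
  define p where "p = (\<Sum>i\<in>I. monom (c i) (N * i))"
  have "map_poly \<iota> p = (\<Sum>i\<in>I. monom (\<iota> (c i)) (N * i))"
    by (rule poly_eqI)
      (auto simp: p_def coeff_map_poly coeff_sum emb_sum intro!: sum.cong)
  then have "poly (map_poly \<iota> p) y = 0"
    using sum0 by (simp add: poly_sum poly_monom)
  then have "p = 0"
    using algebraic_imp_in_base y by blast
  moreover have "coeff p (N * i) = c i"
  proof -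
    have "coeff p (N * i) = (\<Sum>j\<in>I. if j = i then c j else 0)"
      unfolding p_def coeff_sum using \<open>N > 0\<close> by (intro sum.cong) auto
    then show ?thesis
      using i I by simp
  qed
  ultimately show ?thesis
    by simp
qed

end

context field_action
begin

text \<open>
  By independence of the automorphisms \<open>b \<in> G\<close>, the operator \<open>\<Sum>\<^sub>b \<psi>(b)\<^sup>-\<^sup>1 b\<close> is not zero; its
  values have weight \<open>\<psi>\<close>.
\<close>

lemma exists_semi_invariant:
  assumes \<psi>: "\<psi> \<in> hom G unit_group"
  shows "\<exists>y. y \<noteq> 0 \<and> (\<forall>a\<in>carrier G. act a y = \<iota> (\<psi> a) * y)"
proof -
  have \<psi>_nz: "\<psi> a \<noteq> 0" if "a \<in> carrier G" for a
    using \<psi> that by (auto simp: hom_def unit_group_def)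
  have \<psi>_mult: "\<psi> (a \<otimes>\<^bsub>G\<^esub> b) = \<psi> a * \<psi> b" if "a \<in> carrier G" "b \<in> carrier G" for a b
    using \<psi> that by (auto simp: hom_def unit_group_def)
  define y where "y l = (\<Sum>b\<in>carrier G. inverse (\<iota> (\<psi> b)) * act b l)" for l
  have "\<exists>l. y l \<noteq> 0"
  proof (rule ccontr)
    assume "\<not> (\<exists>l. y l \<noteq> 0)"
    then have 0: "y l = 0" for l
      by simp
    define c where "c f = inverse (\<iota> (\<psi> (inv_into (carrier G) act f)))" for f
    have "c (act \<one>\<^bsub>G\<^esub>) = 0"
    proof (rule multiplicative_maps_independent[of "act ` carrier G" c])
      show "(\<Sum>f\<in>act ` carrier G. c f * f l) = 0" for l
        using 0[of l] by (simp add: y_def c_def sum.reindex[OF act_inj_on] inv_into_f_f[OF act_inj_on])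
    qed (use fin act_mult in auto)
    then show False
      using \<psi>_nz[of "\<one>\<^bsub>G\<^esub>"] by (simp add: c_def inv_into_f_f[OF act_inj_on])
  qed
  then obtain l where "y l \<noteq> 0" ..
  moreover have "act a (y l) = \<iota> (\<psi> a) * y l" if a: "a \<in> carrier G" for a
  proof -
    have act_inverse: "act a (inverse (\<iota> k)) = inverse (\<iota> k)" for k
    proof (cases "k = 0")
      case False
      then have "\<iota> (inverse k) * \<iota> k = 1"
        by (simp flip: emb_mult)
      then have "inverse (\<iota> k) = \<iota> (inverse k)"
        by (metis inverse_unique mult.commute)
      then show ?thesis
        using a by simp
    qed (use a in simp)
    have "act a (y l) = (\<Sum>b\<in>carrier G. \<iota> (\<psi> a) * (inverse (\<iota> (\<psi> (a \<otimes>\<^bsub>G\<^esub> b))) * act (a \<otimes>\<^bsub>G\<^esub> b) l))"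
      unfolding y_def using a \<psi>_nz[OF a]
      by (simp add: act_sum act_mult act_compose act_inverse \<psi>_mult emb_mult flip: mult.assoc)
    also have "\<dots> = (\<Sum>b\<in>carrier G. \<iota> (\<psi> a) * (inverse (\<iota> (\<psi> b)) * act b l))"
      by (rule sum.reindex_bij_witness[of _ "\<lambda>b. inv\<^bsub>G\<^esub> a \<otimes>\<^bsub>G\<^esub> b" "\<lambda>b. a \<otimes>\<^bsub>G\<^esub> b"])
        (use a in \<open>auto simp: m_assoc[symmetric]\<close>)
    also have "\<dots> = \<iota> (\<psi> a) * y l"
      by (simp add: y_def sum_distrib_left)
    finally show ?thesis .
  qed
  ultimately show ?thesis
    by blast
qed

end

context hopf_data
begin

sublocale alg_closed_field_extension \<iota>
  by unfold_locales

lemma hom_unit_group_power_card: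
  assumes "\<psi> \<in> hom G (unit_group :: 'k monoid)" "a \<in> carrier G"
  shows "\<psi> a ^ card (carrier G) = 1"
proof -
  have "\<psi> (a [^]\<^bsub>G\<^esub> card (carrier G)) = \<psi> a [^]\<^bsub>unit_group\<^esub> card (carrier G)"
    by (rule hom_nat_pow[OF assms is_group group_unit_group])
  moreover have "\<psi> \<one>\<^bsub>G\<^esub> = 1"
    using group_hom.hom_one[of G unit_group \<psi>] assms(1) is_group group_unit_group
    by (simp add: group_hom_def group_hom_axioms_def) (simp add: unit_group_def)
  ultimately show ?thesis
    using power_order_eq_one[OF fin assms(2)] by (simp add: unit_group_nat_pow)
qed

lemma finite_index_set: "finite (index_set G \<theta> g \<chi> a \<psi>)"
  by (simp add: index_set_def)

lemma module_field_scale: "Modules.module (field_scale \<iota>)"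
  by unfold_locales (simp_all add: field_scale_def algebra_simps emb_add emb_mult)

lemma module_operator_scale: "Modules.module (operator_scale \<iota>)"
  by unfold_locales (simp_all add: operator_scale_def fun_eq_iff algebra_simps emb_add emb_mult)

text \<open>
  A nonzero \<open>y\<^sub>0\<close> of weight \<open>\<chi>\<^sub>1\<close> is moved by \<open>g\<^sub>1\<close>, so it lies outside the algebraically closed field of
  scalars. Its power with exponent \<open>N = card (carrier G)\<close> is invariant, because \<open>\<chi>\<^sub>1\<^sup>N = 1\<close>. Hence
  multiplying the \<open>i\<close>-th semi-invariant by the \<open>i\<close>-th power of \<open>y\<^sub>0\<^sup>N\<close> keeps the weights and makes the
  family independent on every index set.
\<close>

lemma exists_independent_semi_invariants:
  "\<exists>w. semi_invariants G \<theta> \<chi> \<iota> act w \<and>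
    (\<forall>a \<psi>. independent_family (field_scale \<iota>) (index_set G \<theta> g \<chi> a \<psi>) w)"
proof (cases "\<theta> = 0")
  case True
  then show ?thesis
    by (intro exI[of _ "\<lambda>_. 0"])
      (simp add: semi_invariants_def index_set_def independent_family_iff[OF module_field_scale])
next
  case False
  then have one: "1 \<in> {1..\<theta>}"
    by simp
  let ?N = "card (carrier G)"
  have N: "?N > 0"
    using fin by (auto simp: card_gt_0_iff)
  define Y where "Y \<psi> = (SOME y. y \<noteq> 0 \<and> (\<forall>a\<in>carrier G. act a y = \<iota> (\<psi> a) * y))" for \<psi>
  have Y: "Y \<psi> \<noteq> 0 \<and> (\<forall>a\<in>carrier G. act a (Y \<psi>) = \<iota> (\<psi> a) * Y \<psi>)" if "\<psi> \<in> hom G unit_group" for \<psi>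
    unfolding Y_def by (rule someI_ex[OF exists_semi_invariant[OF that]])
  \<comment> \<open>Restriction makes characters that agree on \<open>G\<close> equal as functions, so that \<open>Y\<close> sees them as one.\<close>
  have restr: "restrict (\<chi> i) (carrier G) \<in> hom G unit_group" if "i \<in> {1..\<theta>}" for i
    using \<chi>_hom[OF that] by (auto simp: hom_def)
  define y0 where "y0 = Y (\<chi> 1)"
  note y0 = Y[OF \<chi>_hom[OF one], folded y0_def]
  have "y0 \<notin> range \<iota>"
  proof
    assume "y0 \<in> range \<iota>"
    then have "\<iota> (\<chi> 1 (g 1)) * y0 = y0"
      using y0 g_closed[OF one] by (metis act_emb imageE)
    then have "\<chi> 1 (g 1) = 1"
      using y0 by simp
    then have "group.ord (unit_group :: 'k monoid) (\<chi> 1 (g 1)) = 1"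
      using group.ord_eq_1[OF group_unit_group, of "\<chi> 1 (g 1)"] by (simp add: unit_group_def)
    then show False
      using ord_\<chi>g[OF one] n_ge_2[OF one] by simp
  qed
  define w where "w i = Y (restrict (\<chi> i) (carrier G)) * y0 ^ (?N * i)" for i
  have "semi_invariants G \<theta> \<chi> \<iota> act w"
    unfolding semi_invariants_def
  proof (intro ballI)
    fix i a assume i: "i \<in> {1..\<theta>}" and a: "a \<in> carrier G"
    have "act a (y0 ^ (?N * i)) = (\<iota> (\<chi> 1 a ^ ?N)) ^ i * y0 ^ (?N * i)"
      using y0 a by (simp add: act_power power_mult_distrib power_mult emb_power)
    then have "act a (y0 ^ (?N * i)) = y0 ^ (?N * i)"
      using hom_unit_group_power_card[OF \<chi>_hom[OF one] a] by simp
    then show "act a (w i) = \<iota> (\<chi> i a) * w i"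
      using Y[OF restr[OF i]] a by (simp add: w_def act_mult)
  qed
  moreover have "independent_family (field_scale \<iota>) (index_set G \<theta> g \<chi> a \<psi>) w" for a \<psi>
    unfolding independent_family_iff[OF module_field_scale finite_index_set]
  proof (intro allI impI ballI)
    fix c i
    assume sum0: "(\<Sum>i\<in>index_set G \<theta> g \<chi> a \<psi>. field_scale \<iota> (c i) (w i)) = 0"
      and i: "i \<in> index_set G \<theta> g \<chi> a \<psi>"
    have w: "w j = Y (restrict \<psi> (carrier G)) * y0 ^ (?N * j)"
      if "j \<in> index_set G \<theta> g \<chi> a \<psi>" for j
    proof -
      have "restrict (\<chi> j) (carrier G) = restrict \<psi> (carrier G)"
        using that by (auto simp: index_set_def restrict_def)
      then show ?thesis
        by (simp add: w_def)
    qed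
    have "restrict (\<chi> i) (carrier G) = restrict \<psi> (carrier G)" "i \<in> {1..\<theta>}"
      using i by (auto simp: index_set_def restrict_def)
    then have nz: "Y (restrict \<psi> (carrier G)) \<noteq> 0"
      using Y[OF restr[of i]] by simp
    have "Y (restrict \<psi> (carrier G)) * (\<Sum>i\<in>index_set G \<theta> g \<chi> a \<psi>. \<iota> (c i) * y0 ^ (?N * i))
        = (\<Sum>i\<in>index_set G \<theta> g \<chi> a \<psi>. field_scale \<iota> (c i) (w i))"
      by (simp add: w field_scale_def sum_distrib_left mult.left_commute)
    then have "(\<Sum>i\<in>index_set G \<theta> g \<chi> a \<psi>. \<iota> (c i) * y0 ^ (?N * i)) = 0"
      using sum0 nz by simp
    then show "c i = 0"
      using powers_independent[OF \<open>y0 \<notin> range \<iota>\<close> N finite_index_set] i by blast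
  qed
  ultimately show ?thesis
    by blast
qed

text \<open>
  On an index set all \<open>g\<^sub>i\<close> are the same \<open>a\<close>, so \<open>\<Sum> c\<^sub>i x\<^sub>i = (\<Sum> c\<^sub>i w\<^sub>i) (1 - a)\<close>, and \<open>1 - a\<close> is not
  zero because \<open>G\<close> acts faithfully.
\<close>

lemma independent_operators_iff:
  assumes form: "given_by_formula G \<theta> n g \<chi> act \<rho> w"
  shows "independent_family (operator_scale \<iota>) (index_set G \<theta> g \<chi> a \<psi>) (\<lambda>i. \<rho> (hopf_x G \<theta> n \<chi> i))
    \<longleftrightarrow> independent_family (field_scale \<iota>) (index_set G \<theta> g \<chi> a \<psi>) w"
proof (cases "index_set G \<theta> g \<chi> a \<psi> = {}")
  case True
  then show ?thesis
    by (simp add: independent_family_iff[OF module_field_scale] independent_family_iff[OF module_operator_scale])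
next
  case False
  let ?I = "index_set G \<theta> g \<chi> a \<psi>"
  obtain i where i: "i \<in> {1..\<theta>}" "g i = a"
    using False by (auto simp: index_set_def)
  obtain l where l: "act a l \<noteq> l"
    using act_moves[OF g_closed[OF i(1)] g_neq_one[OF i(1)]] i(2) by metis
  have "(\<Sum>i\<in>?I. operator_scale \<iota> (c i) (\<rho> (hopf_x G \<theta> n \<chi> i)))
      = (\<lambda>m. (\<Sum>i\<in>?I. field_scale \<iota> (c i) (w i)) * (m - act a m))" for c
  proof
    fix m
    have "(\<Sum>i\<in>?I. operator_scale \<iota> (c i) (\<rho> (hopf_x G \<theta> n \<chi> i))) m
        = (\<Sum>i\<in>?I. operator_scale \<iota> (c i) (\<rho> (hopf_x G \<theta> n \<chi> i)) m)"
      using finite_index_set[of a \<psi>] by (induction rule: finite_induct) auto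
    also have "\<dots> = (\<Sum>i\<in>?I. field_scale \<iota> (c i) (w i) * (m - act a m))"
      using form by (intro sum.cong)
        (auto simp: operator_scale_def field_scale_def given_by_formula_def index_set_def)
    finally show "(\<Sum>i\<in>?I. operator_scale \<iota> (c i) (\<rho> (hopf_x G \<theta> n \<chi> i))) m
        = (\<Sum>i\<in>?I. field_scale \<iota> (c i) (w i)) * (m - act a m)"
      by (simp add: sum_distrib_right)
  qed
  then have "(\<Sum>i\<in>?I. operator_scale \<iota> (c i) (\<rho> (hopf_x G \<theta> n \<chi> i))) = 0
      \<longleftrightarrow> (\<Sum>i\<in>?I. field_scale \<iota> (c i) (w i)) = 0" for c
    using l by (auto simp: fun_eq_iff)
  then show ?thesis
    by (simp add: independent_family_iff[OF module_field_scale finite_index_set]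
        independent_family_iff[OF module_operator_scale finite_index_set])
qed

end

section \<open>The classification\<close>

theorem theorem1p4:
  fixes G :: "('g, 'm) monoid_scheme"
    and \<theta> :: nat and n :: "nat \<Rightarrow> nat" and g :: "nat \<Rightarrow> 'g"
    and \<chi> :: "nat \<Rightarrow> 'g \<Rightarrow> 'k::{alg_closed_field, field_char_0}"
    and \<iota> :: "'k \<Rightarrow> 'l::field" and act :: "'g \<Rightarrow> 'l \<Rightarrow> 'l"
  assumes "comm_group G" and "finite (carrier G)"
    and "\<And>i. i \<in> {1..\<theta>} \<Longrightarrow> g i \<in> carrier G"
    and "\<And>i. i \<in> {1..\<theta>} \<Longrightarrow> \<chi> i \<in> hom G unit_group"
    and "\<And>i. i \<in> {1..\<theta>} \<Longrightarrow> n i \<ge> 2"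
    and "\<And>i. i \<in> {1..\<theta>} \<Longrightarrow> group.ord G (g i) = n i"
    and "\<And>i. i \<in> {1..\<theta>} \<Longrightarrow> group.ord unit_group (\<chi> i (g i)) = n i"
    and "field_embedding \<iota>"
    and "faithful_action G (UNIV :: 'l set) act"
    and "\<And>a. a \<in> carrier G \<Longrightarrow> algebra_automorphism \<iota> (act a)"
  shows
    "(\<forall>\<rho>. extends_action G \<theta> n g \<chi> \<iota> act \<rho> \<longrightarrow>
        (\<exists>w. semi_invariants G \<theta> \<chi> \<iota> act w \<and> given_by_formula G \<theta> n g \<chi> act \<rho> w)) \<and>
     (\<forall>w. semi_invariants G \<theta> \<chi> \<iota> act w \<longrightarrow>
        (\<exists>\<rho>. extends_action G \<theta> n g \<chi> \<iota> act \<rho> \<and> given_by_formula G \<theta> n g \<chi> act \<rho> w \<and>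
          (\<forall>\<rho>'. extends_action G \<theta> n g \<chi> \<iota> act \<rho>' \<and> given_by_formula G \<theta> n g \<chi> act \<rho>' w \<longrightarrow>
            (\<forall>h\<in>carrier (hopf_algebra G \<theta> n g \<chi>). \<rho>' h = \<rho> h)))) \<and>
     (\<forall>w \<rho>. semi_invariants G \<theta> \<chi> \<iota> act w \<and> extends_action G \<theta> n g \<chi> \<iota> act \<rho> \<and>
          given_by_formula G \<theta> n g \<chi> act \<rho> w \<longrightarrow>
        (\<forall>a\<in>carrier G. \<forall>\<psi>\<in>hom G unit_group.
          independent_family (operator_scale \<iota>) (index_set G \<theta> g \<chi> a \<psi>) (\<lambda>i. \<rho> (hopf_x G \<theta> n \<chi> i)) \<longleftrightarrow>
          independent_family (field_scale \<iota>) (index_set G \<theta> g \<chi> a \<psi>) w)) \<and>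
     (\<exists>w \<rho>. semi_invariants G \<theta> \<chi> \<iota> act w \<and> extends_action G \<theta> n g \<chi> \<iota> act \<rho> \<and>
          given_by_formula G \<theta> n g \<chi> act \<rho> w \<and>
        (\<forall>a\<in>carrier G. \<forall>\<psi>\<in>hom G unit_group.
          independent_family (operator_scale \<iota>) (index_set G \<theta> g \<chi> a \<psi>) (\<lambda>i. \<rho> (hopf_x G \<theta> n \<chi> i))))"
proof -
  interpret hopf_data \<iota> G act \<theta> n g \<chi>
    by (intro hopf_data.intro field_action.intro field_extension.intro
        field_action_axioms.intro hopf_data_axioms.intro assms)
  have construct: "\<exists>\<rho>. extends_action G \<theta> n g \<chi> \<iota> act \<rho> \<and> given_by_formula G \<theta> n g \<chi> act \<rho> w \<and>
      (\<forall>\<rho>'. extends_action G \<theta> n g \<chi> \<iota> act \<rho>' \<and> given_by_formula G \<theta> n g \<chi> act \<rho>' w \<longrightarrow>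
        (\<forall>h\<in>carrier hopf. \<rho>' h = \<rho> h))"
    if "semi_invariants G \<theta> \<chi> \<iota> act w" for w
  proof -
    interpret skew_action \<iota> G act \<theta> n g \<chi> w
      by unfold_locales (rule that)
    show ?thesis
      using extends_action_hopf_op given_by_formula_hopf_op extension_unique by blast
  qed
  obtain w where w: "semi_invariants G \<theta> \<chi> \<iota> act w"
    "\<And>a \<psi>. independent_family (field_scale \<iota>) (index_set G \<theta> g \<chi> a \<psi>) w"
    using exists_independent_semi_invariants by blast
  obtain \<rho> where \<rho>: "extends_action G \<theta> n g \<chi> \<iota> act \<rho>" "given_by_formula G \<theta> n g \<chi> act \<rho> w"
    using construct[OF w(1)] by blast
  show ?thesis
  proof (intro conjI)
    show "\<exists>w \<rho>. semi_invariants G \<theta> \<chi> \<iota> act w \<and> extends_action G \<theta> n g \<chi> \<iota> act \<rho> \<and>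
          given_by_formula G \<theta> n g \<chi> act \<rho> w \<and>
        (\<forall>a\<in>carrier G. \<forall>\<psi>\<in>hom G unit_group.
          independent_family (operator_scale \<iota>) (index_set G \<theta> g \<chi> a \<psi>) (\<lambda>i. \<rho> (hopf_x G \<theta> n \<chi> i)))"
      using w \<rho> independent_operators_iff[OF \<rho>(2)] by blast
  qed (use extension_given_by_formula construct independent_operators_iff in blast)+
qed

end
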